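(* Let $H$ be a hypergraph on the vertex set $[n]$ and $\boldsymbol{\kappa}=(\kappa_1,\dots,\kappa_n)\in\mathbb{N}^n$. Then the multivariate relaxed $\boldsymbol{\kappa}$-subgraph polynomial $\eta^{\boldsymbol{\kappa}}_H(\mathbf{x})$ is stable, and \[\eta^{\boldsymbol{\kappa}}_H(\mathbf{x})=\prod_{e\in E(H)}\mathrm{MAP}\Big[(1-\boldsymbol{\partial}_e)\prod_{i\in e}(1+\partial_i)\Big]\mathbf{x}^{\boldsymbol{\kappa}}.\]
   Context: A hypergraph $H$ has vertex set $[n]$ and a finite family $E(H)$ of subsets of $[n]$ (edges). A relaxed subgraph $K$ of $H$ is given by a subfamily $E\subseteq E(H)$ together with a choice, for each $e\in E$, of a subset $S_e\subseteq e$ with $|S_e|>1$; its edges are $E(K)=(S_e)_{e\in E}$ (labelled by $e$), $V(K)=\bigcup_{e\in E}S_e$, and $\deg_K(i)=|\{e\in E: i\in S_e\}|$. A relaxed $\boldsymbol{\kappa}$-subgraph is a relaxed subgraph with $\deg_K(i)\le\kappa_i$ for all $i$. With $(m)_k=m(m-1)\cdots(m-k+1)$ and $W(K)=\prod_{e\in E}(|S_e|-1)\cdot\prod_{i\in V(K)}(\kappa_i)_{\deg_K(i)}$, define \[\eta^{\boldsymbol{\kappa}}_H(\mathbf{x})=\sum_{K}(-1)^{|E(K)|}W(K)\prod_{i\in[n]}x_i^{\kappa_i-\deg_K(i)},\] summed over all relaxed $\boldsymbol{\kappa}$-subgraphs $K$ of $H$. Notation: $\partial_i=\partial/\partial x_i$,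 $\boldsymbol{\partial}_e=\sum_{i\in e}\partial_i$, $\mathbf{x}^{\boldsymbol{\kappa}}=\prod_ix_i^{\kappa_i}$. For a polynomial differential operator $\sum_{\boldsymbol{\alpha}}a(\boldsymbol{\alpha})\prod_i\partial_i^{\alpha_i}$, $\mathrm{MAP}$ keeps only the terms with all $\alpha_i\le1$. A polynomial is stable if it is nonzero whenever all variables have positive imaginary part (the zero polynomial is also stable). *)

theory Defs
  imports Complex_Main "HOL-Library.Poly_Mapping" "HOL-Library.FuncSet"
begin

section \<open>Multivariate polynomials and constant-coefficient differential operators\<close>

text \<open>
  Polynomials over the complex numbers in variables \<open>x\<^sub>i\<close> indexed by naturals. A monomial is a
  finitely supported exponent vector; the ring operations (in particular the convolution product)
  are those of \<^theory>\<open>HOL-Library.Poly_Mapping\<close>.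
\<close>

type_synonym cpoly = "(nat \<Rightarrow>\<^sub>0 nat) \<Rightarrow>\<^sub>0 complex"

definition pvar :: "nat \<Rightarrow> cpoly" where
  "pvar i = Poly_Mapping.single (Poly_Mapping.single i 1) 1"

definition pconst :: "complex \<Rightarrow> cpoly" where
  "pconst c = Poly_Mapping.single 0 c"

definition peval :: "(nat \<Rightarrow> complex) \<Rightarrow> cpoly \<Rightarrow> complex" where
  "peval x p = (\<Sum>m\<in>Poly_Mapping.keys p. Poly_Mapping.lookup p m *
      (\<Prod>i\<in>Poly_Mapping.keys m. x i ^ Poly_Mapping.lookup m i))"

text \<open>Stability of a polynomial whose variables are the \<open>x\<^sub>i\<close> with \<open>i \<in> V\<close>.\<close>

definition stable_poly :: "nat set \<Rightarrow> cpoly \<Rightarrow> bool" where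
  "stable_poly V p \<longleftrightarrow> p = 0 \<or> (\<forall>x. (\<forall>i\<in>V. 0 < Im (x i)) \<longrightarrow> peval x p \<noteq> 0)"

text \<open>
  The partial derivative with respect to \<open>x\<^sub>i\<close>, term by term. The truncated subtraction in the
  exponent is harmless: the coefficient vanishes when \<open>x\<^sub>i\<close> does not occur in the monomial.
\<close>

definition partial :: "nat \<Rightarrow> cpoly \<Rightarrow> cpoly" where
  "partial i p = (\<Sum>m\<in>Poly_Mapping.keys p.
      Poly_Mapping.single (m - Poly_Mapping.single i 1)
        (of_nat (Poly_Mapping.lookup m i) * Poly_Mapping.lookup p m))"

text \<open>
  The iterated derivative \<open>\<Prod>\<^sub>i \<partial>\<^sub>i\<^bsup>\<alpha>\<^sub>i\<^esup>\<close>; as partial derivatives commute, the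
  order in which the list runs through the indices is immaterial.
\<close>

definition partials :: "(nat \<Rightarrow>\<^sub>0 nat) \<Rightarrow> cpoly \<Rightarrow> cpoly" where
  "partials \<alpha> =
     foldr (\<lambda>i. partial i ^^ Poly_Mapping.lookup \<alpha> i) (sorted_list_of_set (Poly_Mapping.keys \<alpha>))"

text \<open>
  A differential operator \<open>\<Sum>\<^sub>\<alpha> a(\<alpha>) \<Prod>\<^sub>i \<partial>\<^sub>i\<^bsup>\<alpha>\<^sub>i\<^esup>\<close> with constant coefficients is
  represented by its symbol, the polynomial with coefficients \<open>a(\<alpha>)\<close>; sums and products
  (compositions) of operators are then sums and products of symbols.
\<close>

type_synonym diffop = cpoly

definition Del :: "nat \<Rightarrow> diffop" where
  "Del i = pvar i"

definition Del_sum :: "nat set \<Rightarrow> diffop" where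
  "Del_sum S = (\<Sum>i\<in>S. Del i)"

definition apply_op :: "diffop \<Rightarrow> cpoly \<Rightarrow> cpoly" where
  "apply_op A p = (\<Sum>\<alpha>\<in>Poly_Mapping.keys A. pconst (Poly_Mapping.lookup A \<alpha>) * partials \<alpha> p)"

text \<open>The multiaffine part: discard all terms with some exponent exceeding 1.\<close>

definition MAP :: "diffop \<Rightarrow> diffop" where
  "MAP A = (\<Sum>\<alpha>\<in>{\<alpha> \<in> Poly_Mapping.keys A. \<forall>i. Poly_Mapping.lookup \<alpha> i \<le> 1}.
      Poly_Mapping.single \<alpha> (Poly_Mapping.lookup A \<alpha>))"


section \<open>Hypergraphs and relaxed subgraphs\<close>

text \<open>
  A hypergraph on \<open>{1..n}\<close> is a finite family \<open>(h e)\<^bsub>e \<in> I\<^esub>\<close> of subsets of \<open>{1..n}\<close>. The elements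
  of \<open>I\<close> are edge labels, so repeated edges are allowed; a set \<open>I\<close> of edges is the case \<open>h = id\<close>.
\<close>

definition hypergraph :: "nat \<Rightarrow> 'e set \<Rightarrow> ('e \<Rightarrow> nat set) \<Rightarrow> bool" where
  "hypergraph n I h \<longleftrightarrow> finite I \<and> (\<forall>e\<in>I. h e \<subseteq> {1..n})"

text \<open>
  A relaxed subgraph is a pair \<open>(F, S)\<close> of a set of labels \<open>F \<subseteq> I\<close> and a choice of \<open>S e \<subseteq> h e\<close> with
  at least two elements for each \<open>e \<in> F\<close>. Extensionality of \<open>S\<close> (via \<open>\<Pi>\<^sub>E\<close>) ensures that each
  relaxed subgraph is represented by exactly one pair.
\<close>

type_synonym 'e relaxed = "'e set \<times> ('e \<Rightarrow> nat set)"

definition relaxed_subgraphs :: "'e set \<Rightarrow> ('e \<Rightarrow> nat set) \<Rightarrow> 'e relaxed set" where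
  "relaxed_subgraphs I h = (SIGMA F : Pow I. \<Pi>\<^sub>E e\<in>F. {T. T \<subseteq> h e \<and> card T > 1})"

definition rel_verts :: "'e relaxed \<Rightarrow> nat set" where
  "rel_verts K = (\<Union>e\<in>fst K. snd K e)"

definition rel_deg :: "'e relaxed \<Rightarrow> nat \<Rightarrow> nat" where
  "rel_deg K i = card {e \<in> fst K. i \<in> snd K e}"

definition relaxed_kappa_subgraphs ::
  "nat \<Rightarrow> 'e set \<Rightarrow> ('e \<Rightarrow> nat set) \<Rightarrow> (nat \<Rightarrow> nat) \<Rightarrow> 'e relaxed set" where
  "relaxed_kappa_subgraphs n I h \<kappa> =
     {K \<in> relaxed_subgraphs I h. \<forall>i\<in>{1..n}. rel_deg K i \<le> \<kappa> i}"

definition falling :: "nat \<Rightarrow> nat \<Rightarrow> int" where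
  "falling m k = (\<Prod>j<k. int m - int j)"

definition weight :: "(nat \<Rightarrow> nat) \<Rightarrow> 'e relaxed \<Rightarrow> int" where
  "weight \<kappa> K = (\<Prod>e\<in>fst K. int (card (snd K e)) - 1) *
     (\<Prod>i\<in>rel_verts K. falling (\<kappa> i) (rel_deg K i))"

definition eta :: "nat \<Rightarrow> 'e set \<Rightarrow> ('e \<Rightarrow> nat set) \<Rightarrow> (nat \<Rightarrow> nat) \<Rightarrow> cpoly" where
  "eta n I h \<kappa> = (\<Sum>K\<in>relaxed_kappa_subgraphs n I h \<kappa>.
     (- 1) ^ card (fst K) * of_int (weight \<kappa> K) * (\<Prod>i\<in>{1..n}. pvar i ^ (\<kappa> i - rel_deg K i)))"

text \<open>The sum in \<^const>\<open>eta\<close> is a genuine finite sum.\<close>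

lemma finite_relaxed_kappa_subgraphs:
  assumes "hypergraph n I h"
  shows "finite (relaxed_kappa_subgraphs n I h \<kappa>)"
proof -
  have "finite (h e)" if "e \<in> I" for e
    using assms that unfolding hypergraph_def by (meson finite_atLeastAtMost finite_subset)
  moreover have "finite I"
    using assms by (simp add: hypergraph_def)
  ultimately have "finite (relaxed_subgraphs I h)"
    unfolding relaxed_subgraphs_def
    by (intro finite_SigmaI finite_PiE) (auto intro: finite_subset)
  then show ?thesis
    by (simp add: relaxed_kappa_subgraphs_def)
qed

end

theory Submission
  imports Defs "HOL-Complex_Analysis.Great_Picard"
    "HOL-Computational_Algebra.Fundamental_Theorem_Algebra"
begin

text \<open>
  The multiaffine part of the symbol of an edge \<open>e\<close> is
  \<open>\<Sum>\<^bsub>S \<subseteq> e\<^esub> (1 - |S|) \<Prod>\<^bsub>i \<in> S\<^esub> \<partial>\<^sub>i\<close>. Singletons contribute nothing, so multiplying these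
  symbols out over all edges is a sum over relaxed subgraphs, and applying the result to
  \<open>\<Prod> x\<^sub>i\<^bsup>\<kappa>\<^sub>i\<^esup>\<close> produces the falling factorials.

  For stability, \<open>\<Sum>\<^bsub>S \<subseteq> e\<^esub> (1 - |S|) \<Prod>\<^bsub>i \<in> S\<^esub> v\<^sub>i = \<Prod>(1 + v\<^sub>i) (1 - \<Sum> v\<^sub>i / (1 + v\<^sub>i))\<close> has no zeros when
  all \<open>v\<^sub>i\<close> lie in the lower half-plane, and the Lieb--Sokal argument allows \<open>v\<^sub>i\<close> to be replaced by
  \<open>\<partial>\<^sub>i\<close>, one variable at a time. To avoid degenerate (identically zero) cases along the way, \<open>\<partial>\<^sub>i\<close> is
  first perturbed to \<open>\<partial>\<^sub>i - \<i>\<epsilon>\<close>, which preserves nonvanishing strictly. Hurwitz' theorem on a complex line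
  through a point where the polynomial is nonzero then lets \<open>\<epsilon> \<rightarrow> 0\<close>.
\<close>

section \<open>Differential operators and their symbols\<close>

lemma poly_mapping_sum_single:
  fixes p :: "'a \<Rightarrow>\<^sub>0 'b::comm_monoid_add"
  shows "(\<Sum>m\<in>Poly_Mapping.keys p. Poly_Mapping.single m (Poly_Mapping.lookup p m)) = p"
proof (rule poly_mapping_eqI)
  fix k
  have "(\<Sum>m\<in>Poly_Mapping.keys p. Poly_Mapping.lookup (Poly_Mapping.single m (Poly_Mapping.lookup p m)) k)
      = (\<Sum>m\<in>Poly_Mapping.keys p. if m = k then Poly_Mapping.lookup p m else 0)"
    by (intro sum.cong) (auto simp: lookup_single when_def)
  then show "Poly_Mapping.lookup (\<Sum>m\<in>Poly_Mapping.keys p. Poly_Mapping.single m (Poly_Mapping.lookup p m)) k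
      = Poly_Mapping.lookup p k"
    by (simp add: lookup_sum in_keys_iff)
qed

text \<open>A finitely supported function is a finite sum of single terms, so additive maps are
  determined by those. Most operator identities below are reduced to monomials in this way.\<close>

lemma additive_eqI:
  fixes f g :: "('a \<Rightarrow>\<^sub>0 'b::ab_group_add) \<Rightarrow> 'c::ab_group_add"
  assumes "Modules.additive f" "Modules.additive g"
    and "\<And>m c. f (Poly_Mapping.single m c) = g (Poly_Mapping.single m c)"
  shows "f p = g p"
proof -
  have "f (\<Sum>m\<in>Poly_Mapping.keys p. Poly_Mapping.single m (Poly_Mapping.lookup p m))
      = g (\<Sum>m\<in>Poly_Mapping.keys p. Poly_Mapping.single m (Poly_Mapping.lookup p m))"
    by (simp add: Modules.additive.sum[OF assms(1)] Modules.additive.sum[OF assms(2)] assms(3))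
  then show ?thesis
    by (simp only: poly_mapping_sum_single)
qed

text \<open>Additivity gives \<open>F m 0 = 0\<close>, so all three sums can be extended to the
  union of the supports; cancellation in \<open>p + q\<close> then does no harm. The one lemma
  yields additivity of \<open>partial\<close>, \<open>apply_op\<close> in the operator,
  \<open>MAP\<close>, \<open>peval\<close> and \<open>line_poly\<close>.\<close>

lemma additive_sum_keys:
  fixes F :: "'a \<Rightarrow> 'b::ab_group_add \<Rightarrow> 'c::ab_group_add"
  assumes "\<And>m. Modules.additive (F m)"
  shows "Modules.additive (\<lambda>p. \<Sum>m\<in>Poly_Mapping.keys p. F m (Poly_Mapping.lookup p m))"
proof
  fix p q :: "'a \<Rightarrow>\<^sub>0 'b"
  have F0: "F m 0 = 0" and Fadd: "F m (a + b) = F m a + F m b" for m a b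
    using assms[of m] by (simp_all add: Modules.additive.zero Modules.additive.add)
  let ?U = "Poly_Mapping.keys p \<union> Poly_Mapping.keys q"
  have ext: "(\<Sum>m\<in>Poly_Mapping.keys r. F m (Poly_Mapping.lookup r m)) = (\<Sum>m\<in>?U. F m (Poly_Mapping.lookup r m))"
    if "Poly_Mapping.keys r \<subseteq> ?U" for r
    using that by (intro sum.mono_neutral_left) (auto simp: in_keys_iff F0)
  show "(\<Sum>m\<in>Poly_Mapping.keys (p + q). F m (Poly_Mapping.lookup (p + q) m))
      = (\<Sum>m\<in>Poly_Mapping.keys p. F m (Poly_Mapping.lookup p m))
        + (\<Sum>m\<in>Poly_Mapping.keys q. F m (Poly_Mapping.lookup q m))"
    by (subst (1 2 3) ext) (use Poly_Mapping.keys_add[of p q] in \<open>auto simp: lookup_add Fadd sum.distrib\<close>)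
qed

lemma sum_keys_single:
  assumes "F m 0 = 0"
  shows "(\<Sum>k\<in>Poly_Mapping.keys (Poly_Mapping.single m c). F k (Poly_Mapping.lookup (Poly_Mapping.single m c) k))
    = F m c"
  using assms by auto

lemma additive_comp:
  "Modules.additive f \<Longrightarrow> Modules.additive g \<Longrightarrow> Modules.additive (\<lambda>p. f (g p))"
  by (simp add: Modules.additive_def)

lemma additive_mult_left:
  fixes a :: "'a::ring"
  shows "Modules.additive f \<Longrightarrow> Modules.additive (\<lambda>p. a * f p)"
  by (simp add: Modules.additive_def distrib_left)

lemma pconst_add: "pconst (a + b) = pconst a + pconst b"
  by (simp add: pconst_def single_add)

lemma pconst_diff: "pconst (a - b) = pconst a - pconst b"
  by (simp add: pconst_def single_diff)

lemma pconst_mult: "pconst (a * b) = pconst a * pconst b"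
  by (simp add: pconst_def mult_single)

lemma pconst_mult_single: "pconst a * Poly_Mapping.single m c = Poly_Mapping.single m (a * c)"
  by (simp add: pconst_def mult_single)

lemma pconst_0 [simp]: "pconst 0 = 0"
  by (simp add: pconst_def)

lemma pconst_1 [simp]: "pconst 1 = 1"
  by (simp add: pconst_def)

lemma pconst_of_int: "pconst (of_int k) = of_int k"
  by (simp add: pconst_def)

lemma pconst_of_nat: "pconst (of_nat k) = of_nat k"
  by (simp add: pconst_def)

lemma pconst_power: "pconst (a ^ k) = pconst a ^ k"
  by (induction k) (simp_all add: pconst_mult)

section \<open>Commuting partial derivatives\<close>

lemma additive_partial: "Modules.additive (partial i)"
  unfolding partial_def by (rule additive_sum_keys) (simp add: Modules.additive_def single_add distrib_left)

lemma partial_single: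
  "partial i (Poly_Mapping.single m c)
    = Poly_Mapping.single (m - Poly_Mapping.single i 1) (of_nat (Poly_Mapping.lookup m i) * c)"
  by (simp add: partial_def)

lemma partial_commute: "partial i (partial j p) = partial j (partial i p)"
proof (rule additive_eqI[where f = "\<lambda>p. partial i (partial j p)" and g = "\<lambda>p. partial j (partial i p)"])
  fix m :: "nat \<Rightarrow>\<^sub>0 nat" and c
  show "partial i (partial j (Poly_Mapping.single m c)) = partial j (partial i (Poly_Mapping.single m c))"
  proof (cases "i = j")
    case False
    then have "Poly_Mapping.lookup (Poly_Mapping.single j (1::nat)) i = 0" "Poly_Mapping.lookup (Poly_Mapping.single i (1::nat)) j = 0"
      by (simp_all add: lookup_single)
    moreover have "m - Poly_Mapping.single j 1 - Poly_Mapping.single i 1 = m - Poly_Mapping.single i 1 - Poly_Mapping.single j 1"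
      by (rule poly_mapping_eqI) (simp add: lookup_minus)
    ultimately show ?thesis
      by (simp add: partial_single lookup_minus mult_ac)
  qed simp
qed (rule additive_comp[OF additive_partial additive_partial])+

lemma additive_funpow:
  fixes f :: "'a::ab_group_add \<Rightarrow> 'a"
  shows "Modules.additive f \<Longrightarrow> Modules.additive (f ^^ k)"
  by (induction k) (simp_all add: Modules.additive_def)

lemma additive_partials: "Modules.additive (partials \<alpha>)"
proof -
  have "Modules.additive (foldr (\<lambda>i. partial i ^^ Poly_Mapping.lookup \<alpha> i) xs)" for xs
    by (induction xs) (use additive_funpow[OF additive_partial] in \<open>simp_all add: Modules.additive_def\<close>)
  then show ?thesis
    by (simp add: partials_def)
qed

text \<open>An index with exponent 0 contributes the identity map, so the list may run over any
  finite superset of the support. This brings iterated derivatives with different supports to a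
  common list.\<close>

lemma partials_foldr:
  assumes "finite A" "Poly_Mapping.keys \<alpha> \<subseteq> A"
  shows "partials \<alpha> = foldr (\<lambda>i. partial i ^^ Poly_Mapping.lookup \<alpha> i) (sorted_list_of_set A)"
proof -
  have "sorted_list_of_set (Poly_Mapping.keys \<alpha>)
      = filter (\<lambda>i. i \<in> Poly_Mapping.keys \<alpha>) (sorted_list_of_set A)"
    using assms by (intro sorted_distinct_set_unique) (auto simp: sorted_wrt_filter)
  moreover have "foldr (\<lambda>i. partial i ^^ Poly_Mapping.lookup \<alpha> i) (filter (\<lambda>i. i \<in> Poly_Mapping.keys \<alpha>) xs)
      = foldr (\<lambda>i. partial i ^^ Poly_Mapping.lookup \<alpha> i) xs" for xs
    by (induction xs) (auto simp: in_keys_iff)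
  ultimately show ?thesis
    by (simp add: partials_def)
qed

lemma funpow_commute_comp:
  assumes "\<And>p. f (g p) = g (f p)"
  shows "(f ^^ k) (g p) = g ((f ^^ k) p)"
  by (induction k) (simp_all add: assms)

lemma partials_add: "partials (\<alpha> + \<beta>) p = partials \<alpha> (partials \<beta> p)"
proof -
  define A where "A = Poly_Mapping.keys \<alpha> \<union> Poly_Mapping.keys \<beta>"
  define D where "D \<gamma> = (\<lambda>xs. foldr (\<lambda>i. partial i ^^ Poly_Mapping.lookup \<gamma> i) xs)" for \<gamma> :: "nat \<Rightarrow>\<^sub>0 nat"
  \<comment> \<open>This moves the \<beta>-derivative in \<open>x_i\<close> past the remaining
    \<alpha>-derivatives in the induction that follows.\<close>
  have comm: "D \<gamma> xs ((partial i ^^ k) q) = (partial i ^^ k) (D \<gamma> xs q)" for \<gamma> xs i k q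
  proof (induction xs)
    case (Cons j xs)
    have "(partial j ^^ Poly_Mapping.lookup \<gamma> j) ((partial i ^^ k) r)
        = (partial i ^^ k) ((partial j ^^ Poly_Mapping.lookup \<gamma> j) r)" for r
      by (intro funpow_commute_comp funpow_commute_comp[symmetric] partial_commute)
    with Cons show ?case by (simp add: D_def)
  qed (simp add: D_def)
  have "D (\<alpha> + \<beta>) xs q = D \<alpha> xs (D \<beta> xs q)" for xs q
  proof (induction xs)
    case (Cons i xs)
    then show ?case
      using comm[where \<gamma> = \<alpha> and xs = xs and i = i and k = "Poly_Mapping.lookup \<beta> i" and q = "D \<beta> xs q"]
      by (simp add: D_def lookup_add funpow_add)
  qed (simp add: D_def)
  moreover have "finite A" "Poly_Mapping.keys \<alpha> \<subseteq> A" "Poly_Mapping.keys \<beta> \<subseteq> A"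
      "Poly_Mapping.keys (\<alpha> + \<beta>) \<subseteq> A"
    using Poly_Mapping.keys_add[of \<alpha> \<beta>] by (auto simp: A_def)
  ultimately show ?thesis
    by (simp add: partials_foldr[of A] D_def)
qed

lemma partials_0 [simp]: "partials 0 p = p"
  by (simp add: partials_def)

lemma partials_single: "partials (Poly_Mapping.single i k) p = (partial i ^^ k) p"
  by (simp add: partials_def)

lemma partial_pconst_mult: "partial i (pconst c * p) = pconst c * partial i p"
proof (rule additive_eqI[where f = "\<lambda>p. partial i (pconst c * p)" and g = "\<lambda>p. pconst c * partial i p"])
  have "Modules.additive (\<lambda>p::cpoly. pconst c * p)"
    by (simp add: Modules.additive_def distrib_left)
  then show "Modules.additive (\<lambda>p. partial i (pconst c * p))"
    by (rule additive_comp[OF additive_partial])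
  show "Modules.additive (\<lambda>p. pconst c * partial i p)"
    by (intro additive_mult_left additive_partial)
qed (simp add: pconst_mult_single partial_single mult_ac)

lemma partials_pconst_mult: "partials \<alpha> (pconst c * p) = pconst c * partials \<alpha> p"
proof -
  have "(partial i ^^ k) (pconst c * q) = pconst c * (partial i ^^ k) q" for i k q
    by (induction k) (simp_all add: partial_pconst_mult)
  then have "foldr (\<lambda>i. partial i ^^ Poly_Mapping.lookup \<alpha> i) xs (pconst c * p)
      = pconst c * foldr (\<lambda>i. partial i ^^ Poly_Mapping.lookup \<alpha> i) xs p" for xs
    by (induction xs) simp_all
  then show ?thesis
    by (simp add: partials_def)
qed

section \<open>Composition of operators as multiplication of symbols\<close>

lemma additive_apply_op_left: "Modules.additive (\<lambda>A. apply_op A p)"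
  unfolding apply_op_def by (rule additive_sum_keys) (simp add: Modules.additive_def pconst_add distrib_right)

lemma additive_apply_op: "Modules.additive (apply_op A)"
  using additive_partials
  by (simp add: Modules.additive_def apply_op_def distrib_left sum.distrib)

lemma apply_op_single: "apply_op (Poly_Mapping.single \<alpha> a) p = pconst a * partials \<alpha> p"
  by (simp add: apply_op_def)

text \<open>Both sides are additive in \<open>A\<close> and in \<open>B\<close>; on single terms the
  claim is \<open>partials_add\<close> together with linearity over constants.\<close>

lemma apply_op_mult: "apply_op (A * B) p = apply_op A (apply_op B p)"
proof (rule additive_eqI[where f = "\<lambda>A. apply_op (A * B) p" and g = "\<lambda>A. apply_op A (apply_op B p)"])
  show "Modules.additive (\<lambda>A. apply_op (A * B) p)"
    using additive_apply_op_left by (simp add: Modules.additive_def distrib_right)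
  fix \<alpha> :: "nat \<Rightarrow>\<^sub>0 nat" and a :: complex
  let ?s = "Poly_Mapping.single \<alpha> a"
  show "apply_op (?s * B) p = apply_op ?s (apply_op B p)"
  proof (rule additive_eqI[where f = "\<lambda>B. apply_op (?s * B) p" and g = "\<lambda>B. apply_op ?s (apply_op B p)"])
    show "Modules.additive (\<lambda>B. apply_op (?s * B) p)"
      using additive_apply_op_left by (simp add: Modules.additive_def distrib_left)
    show "Modules.additive (\<lambda>B. apply_op ?s (apply_op B p))"
      by (intro additive_comp[OF additive_apply_op] additive_apply_op_left)
  qed (simp add: mult_single apply_op_single partials_add partials_pconst_mult pconst_mult mult.assoc)
qed (rule additive_apply_op_left)

lemmas apply_op_sum_left = Modules.additive.sum[OF additive_apply_op_left]
lemmas apply_op_add = Modules.additive.add[OF additive_apply_op]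
lemmas apply_op_diff_left = Modules.additive.diff[OF additive_apply_op_left]

lemma apply_op_pconst: "apply_op (pconst c) p = pconst c * p"
  by (simp add: pconst_def apply_op_single)

lemma apply_op_1 [simp]: "apply_op 1 p = p"
  using apply_op_pconst[of 1 p] by simp

lemma apply_op_pconst_mult: "apply_op (pconst c * A) p = pconst c * apply_op A p"
  by (simp add: apply_op_mult apply_op_pconst)

lemma apply_op_Del: "apply_op (Del i) p = partial i p"
  by (simp add: Del_def pvar_def apply_op_single partials_single)

section \<open>Monomials and the multiaffine part\<close>

lemma prod_pvar_power:
  assumes "finite A"
  shows "(\<Prod>i\<in>A. pvar i ^ k i) = Poly_Mapping.single (\<Sum>i\<in>A. Poly_Mapping.single i (k i)) 1"
proof -
  have "pvar i ^ k = Poly_Mapping.single (Poly_Mapping.single i k) 1" for i k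
    by (induction k) (simp_all add: pvar_def mult_single flip: single_add)
  with assms show ?thesis
    by (induction A) (simp_all add: mult_single)
qed

lemma lookup_sum_single:
  assumes "finite A"
  shows "Poly_Mapping.lookup (\<Sum>i\<in>A. Poly_Mapping.single i (k i)) j = (if j \<in> A then k j else 0)"
proof -
  have "(\<Sum>i\<in>A. Poly_Mapping.lookup (Poly_Mapping.single i (k i)) j) = (\<Sum>i\<in>A. if i = j then k i else 0)"
    by (intro sum.cong) (auto simp: lookup_single when_def)
  with assms show ?thesis
    by (simp add: lookup_sum)
qed

lemma prod_Del:
  assumes "finite S"
  shows "(\<Prod>i\<in>S. Del i) = Poly_Mapping.single (\<Sum>i\<in>S. Poly_Mapping.single i 1) 1"
  using prod_pvar_power[OF assms, of "\<lambda>_. 1"] by (simp add: Del_def)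

lemma MAP_conv_if:
  "MAP A = (\<Sum>\<alpha>\<in>Poly_Mapping.keys A.
      if \<forall>i. Poly_Mapping.lookup \<alpha> i \<le> 1 then Poly_Mapping.single \<alpha> (Poly_Mapping.lookup A \<alpha>) else 0)"
  unfolding MAP_def by (rule sum.inter_filter) simp

lemma additive_MAP: "Modules.additive MAP"
  unfolding MAP_conv_if[abs_def]
  by (rule additive_sum_keys) (auto simp: Modules.additive_def single_add)

lemma MAP_single:
  "MAP (Poly_Mapping.single \<alpha> a) = (if \<forall>i. Poly_Mapping.lookup \<alpha> i \<le> 1 then Poly_Mapping.single \<alpha> a else 0)"
  unfolding MAP_conv_if by (rule trans[OF sum_keys_single[where F = "\<lambda>k c. if \<forall>i. Poly_Mapping.lookup k i \<le> 1 then Poly_Mapping.single k c else 0"]]) auto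

text \<open>Double counting of the pairs \<open>(i, T)\<close> with \<open>i \<in> T\<close>: every
  \<open>T\<close> arises once for each of its elements. The identity serves both for the symbol of
  an edge and for its values at complex points.\<close>

lemma sum_insert_Pow_eq_card:
  fixes F :: "'a set \<Rightarrow> 'b::semiring_1"
  assumes "finite A"
  shows "(\<Sum>i\<in>A. \<Sum>S\<in>Pow (A - {i}). F (insert i S)) = (\<Sum>T\<in>Pow A. of_nat (card T) * F T)"
proof -
  have "(\<Sum>i\<in>A. \<Sum>S\<in>Pow (A - {i}). F (insert i S)) = (\<Sum>i\<in>A. \<Sum>T\<in>{T \<in> Pow A. i \<in> T}. F T)"
  proof (rule sum.cong[OF refl])
    fix i assume "i \<in> A"
    then show "(\<Sum>S\<in>Pow (A - {i}). F (insert i S)) = (\<Sum>T\<in>{T \<in> Pow A. i \<in> T}. F T)"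
      by (intro sum.reindex_bij_witness[where i = "\<lambda>T. T - {i}" and j = "insert i"]) auto
  qed
  also have "\<dots> = (\<Sum>T\<in>Pow A. \<Sum>i\<in>{i \<in> A. i \<in> T}. F T)"
    using assms by (intro sum.swap_restrict) auto
  also have "\<dots> = (\<Sum>T\<in>Pow A. of_nat (card T) * F T)"
  proof (intro sum.cong refl)
    fix T assume "T \<in> Pow A"
    then have "{i \<in> A. i \<in> T} = T" by auto
    then show "(\<Sum>i\<in>{i \<in> A. i \<in> T}. F T) = of_nat (card T) * F T" by simp
  qed
  finally show ?thesis .
qed

lemma prod_one_plus:
  fixes f :: "'a \<Rightarrow> 'b::comm_semiring_1"
  assumes "finite A"
  shows "(\<Prod>i\<in>A. 1 + f i) = (\<Sum>S\<in>Pow A. \<Prod>i\<in>S. f i)"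
  using prod_add[OF assms, of f "\<lambda>_. 1"] by (simp add: add.commute)

lemma MAP_prod_Del:
  assumes "finite S"
  shows "MAP (\<Prod>i\<in>S. Del i) = (\<Prod>i\<in>S. Del i)"
  using lookup_sum_single[OF assms, of "\<lambda>_. 1::nat"] by (simp add: prod_Del[OF assms] MAP_single del: One_nat_def)

lemma MAP_Del_mult_prod_Del:
  assumes "finite S"
  shows "MAP (Del i * (\<Prod>j\<in>S. Del j)) = (if i \<in> S then 0 else (\<Prod>j\<in>insert i S. Del j))"
proof (cases "i \<in> S")
  case True
  define \<alpha> where "\<alpha> = Poly_Mapping.single i 1 + (\<Sum>j\<in>S. Poly_Mapping.single j (1::nat))"
  have "Del i * (\<Prod>j\<in>S. Del j) = Poly_Mapping.single \<alpha> 1"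
    unfolding prod_Del[OF assms] \<alpha>_def by (simp add: Del_def pvar_def mult_single)
  moreover have "Poly_Mapping.lookup \<alpha> i = 2"
    using lookup_sum_single[OF assms, of "\<lambda>_. 1::nat" i] True
    by (simp add: \<alpha>_def lookup_add del: One_nat_def)
  then have "\<not> (\<forall>i. Poly_Mapping.lookup \<alpha> i \<le> 1)"
    by (auto intro!: exI[of _ i])
  ultimately show ?thesis
    using True by (simp only: MAP_single if_True if_False)
next
  case False
  with MAP_prod_Del[of "insert i S"] assms show ?thesis by simp
qed

text \<open>The product of the \<open>1 + Del i\<close> contributes each squarefree monomial once.
  In its product with \<open>Del_sum e\<close>, terms with a square are discarded, and the monomial
  of \<open>T\<close> survives once for each \<open>i \<in> T\<close>, coming from
  \<open>T - {i}\<close>. The difference is \<open>1 - card T\<close>.\<close>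

lemma MAP_relaxed_symbol:
  assumes e: "finite e"
  shows "MAP ((1 - Del_sum e) * (\<Prod>i\<in>e. 1 + Del i))
    = (\<Sum>S\<in>Pow e. pconst (1 - of_nat (card S)) * (\<Prod>i\<in>S. Del i))"
proof -
  have fin: "finite S" if "S \<in> Pow e" for S
    using that e finite_subset by auto
  have "(1 - Del_sum e) * (\<Prod>i\<in>e. 1 + Del i)
      = (\<Sum>S\<in>Pow e. \<Prod>i\<in>S. Del i) - (\<Sum>i\<in>e. \<Sum>S\<in>Pow e. Del i * (\<Prod>j\<in>S. Del j))"
    by (simp add: prod_one_plus[OF e] Del_sum_def left_diff_distrib sum_product)
  then have "MAP ((1 - Del_sum e) * (\<Prod>i\<in>e. 1 + Del i))
      = (\<Sum>S\<in>Pow e. \<Prod>i\<in>S. Del i)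
        - (\<Sum>i\<in>e. \<Sum>S\<in>Pow e. if i \<in> S then 0 else (\<Prod>j\<in>insert i S. Del j))"
    by (simp add: Modules.additive.diff[OF additive_MAP] Modules.additive.sum[OF additive_MAP]
        MAP_prod_Del fin MAP_Del_mult_prod_Del cong: sum.cong_simp)
  also have "(\<Sum>i\<in>e. \<Sum>S\<in>Pow e. if i \<in> S then 0 else (\<Prod>j\<in>insert i S. Del j))
      = (\<Sum>i\<in>e. \<Sum>S\<in>Pow (e - {i}). \<Prod>j\<in>insert i S. Del j)"
    using e by (intro sum.cong sum.mono_neutral_cong_right) auto
  also have "\<dots> = (\<Sum>S\<in>Pow e. of_nat (card S) * (\<Prod>j\<in>S. Del j))"
    by (rule sum_insert_Pow_eq_card[OF e])
  finally show ?thesis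
    by (simp add: sum_subtractf[symmetric] left_diff_distrib pconst_diff pconst_of_nat)
qed


section \<open>Expansion over relaxed subgraphs\<close>

lemma falling_0 [simp]: "falling m 0 = 1"
  by (simp add: falling_def)

lemma falling_Suc: "falling m (Suc k) = falling m k * (int m - int k)"
  by (simp add: falling_def)

lemma falling_eq_0: "m < k \<Longrightarrow> falling m k = 0"
  by (auto simp: falling_def)

lemma partial_funpow_single:
  "(partial i ^^ k) (Poly_Mapping.single m c)
    = Poly_Mapping.single (m - Poly_Mapping.single i k) (of_int (falling (Poly_Mapping.lookup m i) k) * c)"
proof (induction k)
  case (Suc k)
  let ?m = "Poly_Mapping.lookup m i"
  have "m - Poly_Mapping.single i k - Poly_Mapping.single i 1 = m - Poly_Mapping.single i (Suc k)"
    by (simp add: diff_diff_eq flip: single_add)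
  \<comment> \<open>For \<open>k > ?m\<close> the subtraction truncates, but then
    \<open>falling ?m k\<close> is already 0, so both sides vanish.\<close>
  moreover have "of_nat (?m - k) * of_int (falling ?m k) = (of_int (falling ?m (Suc k)) :: complex)"
    by (cases "k \<le> ?m") (simp_all add: falling_Suc falling_eq_0 of_nat_diff)
  ultimately show ?case
    using Suc by (simp add: partial_single lookup_minus mult.assoc[symmetric])
qed simp

lemma partials_sum_single:
  assumes "finite A"
  shows "partials (\<Sum>i\<in>A. Poly_Mapping.single i (k i)) (Poly_Mapping.single m c)
    = Poly_Mapping.single (m - (\<Sum>i\<in>A. Poly_Mapping.single i (k i)))
        (of_int (\<Prod>i\<in>A. falling (Poly_Mapping.lookup m i) (k i)) * c)"
  using assms
proof (induction A)
  case (insert a A)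
  then have "Poly_Mapping.lookup (\<Sum>i\<in>A. Poly_Mapping.single i (k i)) a = 0"
    by (simp add: lookup_sum_single)
  moreover have "m - (\<Sum>i\<in>A. Poly_Mapping.single i (k i)) - Poly_Mapping.single a (k a)
      = m - (Poly_Mapping.single a (k a) + (\<Sum>i\<in>A. Poly_Mapping.single i (k i)))"
    by (metis add.commute diff_diff_eq)
  ultimately show ?case
    using insert by (simp add: partials_add partials_single partial_funpow_single lookup_minus mult.assoc)
qed simp

section \<open>Degree vectors of relaxed subgraphs\<close>

text \<open>The exponent vector of the product of the monomials of all chosen sets
  \<open>S e\<close>; its entries turn out to be the degrees \<open>rel_deg K i\<close>.\<close>

definition deg_monom :: "'e relaxed \<Rightarrow> nat \<Rightarrow>\<^sub>0 nat" where
  "deg_monom K = (\<Sum>e\<in>fst K. \<Sum>i\<in>snd K e. Poly_Mapping.single i 1)"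

lemma hypergraph_finite_edge:
  assumes "hypergraph n I h" "e \<in> I"
  shows "finite (h e)"
  using assms unfolding hypergraph_def by (meson finite_atLeastAtMost finite_subset)

lemma relaxed_subgraphD:
  assumes "hypergraph n I h" "K \<in> relaxed_subgraphs I h"
  shows "finite (fst K)" "fst K \<subseteq> I"
    and "\<And>e. e \<in> fst K \<Longrightarrow> snd K e \<subseteq> {1..n}"
    and "\<And>e. e \<in> fst K \<Longrightarrow> finite (snd K e)"
    and "\<And>e. e \<in> fst K \<Longrightarrow> 1 < card (snd K e)"
proof -
  have K: "fst K \<subseteq> I" "\<And>e. e \<in> fst K \<Longrightarrow> snd K e \<subseteq> h e \<and> 1 < card (snd K e)"
    using assms(2) by (fastforce simp: relaxed_subgraphs_def PiE_def Pi_def)+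
  show "fst K \<subseteq> I" and "finite (fst K)"
    using K(1) assms(1) by (auto simp: hypergraph_def intro: finite_subset)
  show S: "snd K e \<subseteq> {1..n}" if "e \<in> fst K" for e
    using K(1) K(2)[OF that] assms(1) that unfolding hypergraph_def by blast
  show "finite (snd K e)" if "e \<in> fst K" for e
    using S[OF that] finite_subset by blast
  show "1 < card (snd K e)" if "e \<in> fst K" for e
    using K(2)[OF that] by blast
qed

lemma finite_relaxed_subgraphs:
  assumes "hypergraph n I h"
  shows "finite (relaxed_subgraphs I h)"
proof -
  have "finite I"
    using assms by (simp add: hypergraph_def)
  then show ?thesis
    unfolding relaxed_subgraphs_def using hypergraph_finite_edge[OF assms]
    by (intro finite_SigmaI finite_PiE) (auto intro: finite_subset)
qed

lemma lookup_deg_monom: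
  assumes "hypergraph n I h" "K \<in> relaxed_subgraphs I h"
  shows "Poly_Mapping.lookup (deg_monom K) i = rel_deg K i"
proof -
  note K = relaxed_subgraphD[OF assms]
  have "Poly_Mapping.lookup (deg_monom K) i = (\<Sum>e\<in>fst K. if i \<in> snd K e then 1 else 0)"
    unfolding deg_monom_def lookup_sum[of _ "fst K"]
    by (intro sum.cong refl) (simp add: lookup_sum_single K(4))
  also have "\<dots> = rel_deg K i"
    using K(1) by (simp add: rel_deg_def sum.inter_filter[symmetric])
  finally show ?thesis .
qed

lemma rel_deg_eq_0:
  assumes "hypergraph n I h" "K \<in> relaxed_subgraphs I h" "i \<notin> rel_verts K"
  shows "rel_deg K i = 0"
proof -
  have "{e \<in> fst K. i \<in> snd K e} = {}"
    using assms(3) by (auto simp: rel_verts_def)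
  then show ?thesis by (simp only: rel_deg_def card.empty)
qed

text \<open>Degrees vanish off \<open>rel_verts K\<close>, which lies in \<open>{1..n}\<close>. The
  index set is thus the same for every \<open>K\<close>, as needed to differentiate the monomial
  over \<open>{1..n}\<close>.\<close>

lemma deg_monom_eq:
  assumes "hypergraph n I h" "K \<in> relaxed_subgraphs I h"
  shows "deg_monom K = (\<Sum>i\<in>{1..n}. Poly_Mapping.single i (rel_deg K i))"
proof (rule poly_mapping_eqI)
  fix i
  have "rel_verts K \<subseteq> {1..n}"
    using relaxed_subgraphD(3)[OF assms] by (auto simp: rel_verts_def)
  then have "rel_deg K i = 0" if "i \<notin> {1..n}"
    using rel_deg_eq_0[OF assms] that by blast
  then show "Poly_Mapping.lookup (deg_monom K) i
      = Poly_Mapping.lookup (\<Sum>i\<in>{1..n}. Poly_Mapping.single i (rel_deg K i)) i"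
    by (subst lookup_sum_single) (auto simp: lookup_deg_monom[OF assms])
qed

section \<open>Multiplying out over the edges\<close>

text \<open>The coefficient \<open>1 - card T\<close> is 1 for the empty set and 0 for singletons;
  what remains are the sets with at least two elements, exactly the choices permitted in a relaxed
  subgraph.\<close>

lemma relaxed_symbol_expansion:
  assumes "finite e"
  shows "MAP ((1 - Del_sum e) * (\<Prod>i\<in>e. 1 + Del i))
    = 1 - (\<Sum>T\<in>{T. T \<subseteq> e \<and> card T > 1}.
        Poly_Mapping.single (\<Sum>i\<in>T. Poly_Mapping.single i 1) (of_int (int (card T) - 1)))"
    (is "_ = 1 - sum ?f ?P")
proof -
  have coeff_T: "pconst (1 - of_nat (card T)) * (\<Prod>i\<in>T. Del i) = (if T = {} then 1 else if card T > 1 then - ?f T else 0)"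
    if "T \<subseteq> e" for T
  proof -
    have "finite T" using that assms by (rule finite_subset)
    consider "T = {}" | "card T = 1" | "card T > 1"
      using \<open>finite T\<close> by (metis card_0_eq less_one linorder_less_linear)
    then show ?thesis
    proof cases
      case 3
      then show ?thesis
        by (auto simp: prod_Del[OF \<open>finite T\<close>] pconst_mult_single simp flip: single_uminus)
    qed auto
  qed
  have "MAP ((1 - Del_sum e) * (\<Prod>i\<in>e. 1 + Del i))
      = (\<Sum>T\<in>Pow e. if T = {} then 1 else if card T > 1 then - ?f T else 0)"
    unfolding MAP_relaxed_symbol[OF assms] by (intro sum.cong refl coeff_T) auto
  also have "\<dots> = 1 + (\<Sum>T\<in>Pow e - {{}}. if card T > 1 then - ?f T else 0)"
    using assms by (subst sum.remove[of _ "{}"]) auto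
  also have "(\<Sum>T\<in>Pow e - {{}}. if card T > 1 then - ?f T else 0) = (\<Sum>T\<in>?P. - ?f T)"
    using assms by (intro sum.mono_neutral_cong_right) auto
  finally show ?thesis by (simp add: sum_negf)
qed

lemma prod_single:
  fixes c :: "'a \<Rightarrow> 'c::comm_semiring_1" and m :: "'a \<Rightarrow> 'b::comm_monoid_add"
  shows "(\<Prod>x\<in>A. Poly_Mapping.single (m x) (c x)) = Poly_Mapping.single (\<Sum>x\<in>A. m x) (\<Prod>x\<in>A. c x)"
  by (induction A rule: infinite_finite_induct) (simp_all add: mult_single)

text \<open>In a product of factors \<open>1 - sum f (P e)\<close>, one selects the set
  \<open>F\<close> of labels whose factor contributes its sum, and then a term \<open>S e\<close>
  for each \<open>e \<in> F\<close>. These pairs \<open>(F, S)\<close> are the relaxed subgraphs,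
  and each selected factor contributes one sign.\<close>

lemma relaxed_operator_expansion:
  assumes H: "hypergraph n I h"
  shows "(\<Prod>e\<in>I. MAP ((1 - Del_sum (h e)) * (\<Prod>i\<in>h e. 1 + Del i)))
    = (\<Sum>K\<in>relaxed_subgraphs I h. Poly_Mapping.single (deg_monom K)
        ((-1) ^ card (fst K) * of_int (\<Prod>e\<in>fst K. int (card (snd K e)) - 1)))"
proof -
  define P where "P e = {T. T \<subseteq> h e \<and> card T > 1}" for e
  define f :: "nat set \<Rightarrow> diffop"
    where "f T = Poly_Mapping.single (\<Sum>i\<in>T. Poly_Mapping.single i 1) (of_int (int (card T) - 1))" for T
  have I: "finite I"
    using H by (simp add: hypergraph_def)
  have finP: "finite (P e)" if "e \<in> I" for e
    using hypergraph_finite_edge[OF H that] by (auto simp: P_def)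
  have "(\<Prod>e\<in>I. MAP ((1 - Del_sum (h e)) * (\<Prod>i\<in>h e. 1 + Del i))) = (\<Prod>e\<in>I. 1 - sum f (P e))"
    by (intro prod.cong refl)
      (simp add: relaxed_symbol_expansion[OF hypergraph_finite_edge[OF H]] f_def P_def)
  also have "\<dots> = (\<Sum>F\<in>Pow I. (-1) ^ card F * (\<Prod>e\<in>F. sum f (P e)))"
    using prod_diff_conv_sum[OF I, of "\<lambda>_. 1" "\<lambda>e. sum f (P e)"] by simp
  also have "\<dots> = (\<Sum>F\<in>Pow I. \<Sum>S\<in>Pi\<^sub>E F P. (-1) ^ card F * (\<Prod>e\<in>F. f (S e)))"
  proof (intro sum.cong refl)
    fix F assume "F \<in> Pow I"
    then have "finite F" "\<And>e. e \<in> F \<Longrightarrow> finite (P e)"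
      using I finP finite_subset by auto
    then have "(\<Prod>e\<in>F. sum f (P e)) = (\<Sum>S\<in>Pi\<^sub>E F P. \<Prod>e\<in>F. f (S e))"
      by (intro prod_sum_PiE)
    then show "(-1) ^ card F * (\<Prod>e\<in>F. sum f (P e)) = (\<Sum>S\<in>Pi\<^sub>E F P. (-1) ^ card F * (\<Prod>e\<in>F. f (S e)))"
      by (simp add: sum_distrib_left)
  qed
  also have "\<dots> = (\<Sum>K\<in>relaxed_subgraphs I h. (-1) ^ card (fst K) * (\<Prod>e\<in>fst K. f (snd K e)))"
  proof -
    have rel: "relaxed_subgraphs I h = (SIGMA F : Pow I. Pi\<^sub>E F P)"
      by (simp add: relaxed_subgraphs_def P_def[abs_def])
    have "\<forall>F\<in>Pow I. finite (Pi\<^sub>E F P)"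
      using I finP finite_subset by (intro ballI finite_PiE) auto
    with I show ?thesis
      unfolding rel by (subst sum.Sigma) (simp_all add: case_prod_unfold)
  qed
  also have "\<dots> = (\<Sum>K\<in>relaxed_subgraphs I h. Poly_Mapping.single (deg_monom K)
        ((-1) ^ card (fst K) * of_int (\<Prod>e\<in>fst K. int (card (snd K e)) - 1)))"
  proof (intro sum.cong refl)
    fix K :: "'a relaxed"
    have "(-1) ^ card (fst K) = pconst ((-1) ^ card (fst K))"
      using pconst_of_int[of "(-1) ^ card (fst K)"] by simp
    then show "(-1) ^ card (fst K) * (\<Prod>e\<in>fst K. f (snd K e)) = Poly_Mapping.single (deg_monom K)
        ((-1) ^ card (fst K) * of_int (\<Prod>e\<in>fst K. int (card (snd K e)) - 1))"
      by (simp add: f_def prod_single deg_monom_def pconst_mult_single)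
  qed
  finally show ?thesis .
qed

lemma eta_eq_apply_op:
  assumes H: "hypergraph n I h"
  shows "eta n I h \<kappa> =
      apply_op (\<Prod>e\<in>I. MAP ((1 - Del_sum (h e)) * (\<Prod>i\<in>h e. 1 + Del i)))
        (\<Prod>i\<in>{1..n}. pvar i ^ \<kappa> i)"
proof -
  define M where "M = (\<Sum>i\<in>{1..n}. Poly_Mapping.single i (\<kappa> i))"
  define c where "c K = ((-1) ^ card (fst K) :: complex) * of_int (\<Prod>e\<in>fst K. int (card (snd K e)) - 1)"
    for K :: "'a relaxed"
  define T where "T K = pconst (c K) * partials (deg_monom K) (Poly_Mapping.single M 1)" for K :: "'a relaxed"
  \<comment> \<open>The term of an arbitrary relaxed subgraph is either its summand in
    \<open>eta\<close> or zero, so the degree bound need not be imposed on the operator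
    side.\<close>
  have T_eq: "T K = (if \<forall>i\<in>{1..n}. rel_deg K i \<le> \<kappa> i then
      (-1) ^ card (fst K) * of_int (weight \<kappa> K) * (\<Prod>i\<in>{1..n}. pvar i ^ (\<kappa> i - rel_deg K i)) else 0)"
    if K: "K \<in> relaxed_subgraphs I h" for K
  proof -
    have M: "Poly_Mapping.lookup M i = \<kappa> i" if "i \<in> {1..n}" for i
      unfolding M_def using that by (subst lookup_sum_single) auto
    have "M - (\<Sum>i\<in>{1..n}. Poly_Mapping.single i (rel_deg K i))
        = (\<Sum>i\<in>{1..n}. Poly_Mapping.single i (\<kappa> i - rel_deg K i))"
      unfolding M_def by (intro poly_mapping_eqI) (simp add: lookup_minus lookup_sum_single)
    then have T1: "T K = pconst (c K * of_int (\<Prod>i\<in>{1..n}. falling (\<kappa> i) (rel_deg K i)))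
        * (\<Prod>i\<in>{1..n}. pvar i ^ (\<kappa> i - rel_deg K i))"
      unfolding T_def deg_monom_eq[OF H K]
      by (subst partials_sum_single) (simp_all add: M prod_pvar_power pconst_mult_single)
    show ?thesis
    proof (cases "\<forall>i\<in>{1..n}. rel_deg K i \<le> \<kappa> i")
      case True
      \<comment> \<open>At vertices outside \<open>rel_verts K\<close> the degree is 0 and the
        falling factorial is 1.\<close>
      have "(\<Prod>i\<in>{1..n}. falling (\<kappa> i) (rel_deg K i)) = (\<Prod>i\<in>rel_verts K. falling (\<kappa> i) (rel_deg K i))"
        using relaxed_subgraphD(3)[OF H K] rel_deg_eq_0[OF H K]
        by (intro prod.mono_neutral_right) (auto simp: rel_verts_def)
      then have "c K * of_int (\<Prod>i\<in>{1..n}. falling (\<kappa> i) (rel_deg K i)) = of_int ((-1) ^ card (fst K) * weight \<kappa> K)"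
        by (simp add: c_def weight_def)
      with T1 True show ?thesis
        by (simp only: pconst_of_int) simp
    next
      case False
      \<comment> \<open>A vertex whose degree exceeds its \<kappa>-value is differentiated too
        often, so its falling factorial contains the factor 0.\<close>
      then have "(\<Prod>i\<in>{1..n}. falling (\<kappa> i) (rel_deg K i)) = 0"
        by (intro prod_zero) (auto intro!: bexI falling_eq_0 simp: not_le)
      with T1 False show ?thesis by (simp only: of_int_0 mult_zero_right pconst_0 mult_zero_left if_False)
    qed
  qed
  have "apply_op (\<Prod>e\<in>I. MAP ((1 - Del_sum (h e)) * (\<Prod>i\<in>h e. 1 + Del i))) (\<Prod>i\<in>{1..n}. pvar i ^ \<kappa> i)
      = (\<Sum>K\<in>relaxed_subgraphs I h. T K)"
    by (simp only: relaxed_operator_expansion[OF H] prod_pvar_power[OF finite_atLeastAtMost]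
        apply_op_sum_left apply_op_single T_def c_def M_def)
  also have "\<dots> = eta n I h \<kappa>"
    unfolding eta_def relaxed_kappa_subgraphs_def sum.inter_filter[OF finite_relaxed_subgraphs[OF H]]
    by (intro sum.cong refl T_eq)
  finally show ?thesis by simp
qed


section \<open>The Lieb--Sokal argument\<close>

text \<open>The logarithmic derivative is the sum of \<open>1 / (t - r)\<close> over the roots
  \<open>r\<close>. Each root has \<open>Im r \<le> 0\<close>, hence \<open>Im (t - r) > 0\<close>
  and the summand has nonpositive imaginary part. The induction splits off one root at a
  time.\<close>

lemma Im_logderiv_poly_nonpos:
  fixes q :: "complex poly"
  assumes "\<And>t. 0 < Im t \<Longrightarrow> poly q t \<noteq> 0" and "0 < Im t"
  shows "Im (poly (pderiv q) t / poly q t) \<le> 0"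
  using assms(1)
proof (induction "degree q" arbitrary: q)
  case 0
  then obtain c where "q = [:c:]"
    by (metis degree_eq_zeroE)
  then show ?case
    by (simp add: pderiv_pCons)
next
  case (Suc d)
  then obtain r where r: "poly q r = 0"
    using alg_closed_imp_poly_has_root[of q] by auto
  then obtain p where p: "q = [:- r, 1:] * p"
    by (auto simp: poly_eq_0_iff_dvd elim: dvdE)
  have q0: "q \<noteq> 0"
    using Suc.hyps(2) by auto
  then have "p \<noteq> 0" "degree p = d"
    using Suc.hyps(2) by (auto simp: p degree_mult_eq simp del: mult_pCons_left)
  have "Im r \<le> 0"
    using Suc.prems[of r] r by force
  then have "0 < Im (t - r)"
    using assms(2) by simp
  then have "Im (1 / (t - r)) \<le> 0"
    by (simp add: Im_divide divide_nonpos_nonneg)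
  moreover have nz: "poly p s \<noteq> 0" if "0 < Im s" for s
    using Suc.prems[OF that] by (auto simp: p)
  then have "Im (poly (pderiv p) t / poly p t) \<le> 0"
    using Suc.hyps(1)[of p] \<open>degree p = d\<close> by simp
  moreover have "poly (pderiv q) t / poly q t = 1 / (t - r) + poly (pderiv p) t / poly p t"
  proof -
    have "poly (pderiv q) t = poly p t + (t - r) * poly (pderiv p) t"
      unfolding p pderiv_mult poly_add poly_mult by (simp add: pderiv_pCons algebra_simps)
    moreover have "t - r \<noteq> 0"
      using \<open>0 < Im (t - r)\<close> by auto
    ultimately show ?thesis
      using nz[OF assms(2)] by (simp add: p field_simps)
  qed
  ultimately show ?case by simp
qed

lemma lieb_sokal_leading_nonzero:
  fixes A B :: "complex poly"
  assumes AB: "\<And>t v. 0 < Im t \<Longrightarrow> 0 < Im v \<Longrightarrow> poly A t + v * poly B t \<noteq> 0"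
    and "B \<noteq> 0" and t: "0 < Im t"
  shows "poly B t \<noteq> 0"
proof
  assume Bt: "poly B t = 0"
  \<comment> \<open>Near a zero of \<open>B\<close> the open map \<open>B / A\<close> attains the value \<open>- 1 / v\<close> for some \<open>v\<close> on the positive
    imaginary axis.\<close>
  have At: "poly A t \<noteq> 0"
    using AB[OF t, of \<i>] Bt by simp
  define U where "U = {s. 0 < Im s} \<inter> {s. poly A s \<noteq> 0}"
  have "open U"
    unfolding U_def by (intro open_Int open_halfspace_Im_gt open_Collect_neq continuous_intros)
  moreover have "t \<in> U"
    using t At by (simp add: U_def)
  ultimately obtain r where r: "0 < r" "ball t r \<subseteq> U"
    using open_contains_ball by blast
  define g where "g s = poly B s / poly A s" for s
  have hol: "g holomorphic_on ball t r"
    unfolding g_def using r(2) by (intro holomorphic_intros) (auto simp: U_def)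
  \<comment> \<open>A constant \<open>g\<close> would equal \<open>g t = 0\<close> on the ball,
    giving the nonzero polynomial \<open>B\<close> infinitely many roots.\<close>
  have "\<not> g constant_on ball t r"
  proof
    assume "g constant_on ball t r"
    then obtain c where "\<And>s. s \<in> ball t r \<Longrightarrow> g s = c"
      by (auto simp: constant_on_def)
    moreover have "g t = 0"
      by (simp add: g_def Bt)
    ultimately have "g s = 0" if "s \<in> ball t r" for s
      using r(1) that centre_in_ball by metis
    moreover have "poly A s \<noteq> 0" if "s \<in> ball t r" for s
      using r(2) that by (auto simp: U_def)
    ultimately have "ball t r \<subseteq> {s. poly B s = 0}"
      by (force simp: g_def)
    then have "finite (ball t r)"
      using poly_roots_finite[OF \<open>B \<noteq> 0\<close>] finite_subset by blast
    then show False
      using uncountable_ball[OF r(1)] countable_finite by blast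
  qed
  then have "open (g ` ball t r)"
    by (intro open_mapping_thm[OF hol]) auto
  moreover have "0 \<in> g ` ball t r"
    using r(1) by (force simp: g_def Bt intro!: image_eqI[of _ _ t])
  ultimately obtain d where d: "0 < d" "ball 0 d \<subseteq> g ` ball t r"
    using open_contains_ball by blast
  then have "\<i> * of_real (d / 2) \<in> g ` ball t r"
    by (intro subsetD[OF d(2)]) (simp add: norm_mult)
  then obtain s where s: "s \<in> ball t r" "\<i> * of_real (d / 2) = g s"
    by blast
  have sU: "0 < Im s" "poly A s \<noteq> 0"
    using r(2) s(1) by (auto simp: U_def)
  define v where "v = \<i> * of_real (2 / d)"
  have "v * (\<i> * of_real (d / 2)) = - 1"
    using d(1) by (simp add: v_def field_simps)
  then have "v * (poly B s / poly A s) = - 1"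
    by (simp only: s(2) g_def)
  then have "v * poly B s = - poly A s"
    using sU(2) by (simp add: divide_eq_eq)
  then have "poly A s + v * poly B s = 0"
    by simp
  moreover have "0 < Im v"
    using d(1) by (simp add: v_def)
  ultimately show False
    using AB[OF sU(1)] by blast
qed

text \<open>The variable \<open>v\<close> is replaced by \<open>-d/dt + \<i> * \<epsilon>\<close>.
  For \<open>B \<noteq> 0\<close>, division by \<open>B\<close> is legitimate by the preceding
  lemma. Then \<open>A / B\<close> has nonnegative imaginary part, since otherwise
  \<open>v = - A / B\<close> would be an admissible zero, and so has \<open>- B' / B\<close>; the
  \<epsilon>-term makes the total strictly positive.\<close>

lemma lieb_sokal_strict:
  fixes A B :: "complex poly"
  assumes AB: "\<And>t v. 0 < Im t \<Longrightarrow> 0 < Im v \<Longrightarrow> poly A t + v * poly B t \<noteq> 0"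
    and "0 < \<epsilon>" and t: "0 < Im t"
  shows "poly A t - poly (pderiv B) t + \<i> * of_real \<epsilon> * poly B t \<noteq> 0"
proof (cases "B = 0")
  case True
  then show ?thesis
    using AB[OF t, of \<i>] by simp
next
  case False
  have nz: "\<And>s. 0 < Im s \<Longrightarrow> poly B s \<noteq> 0"
    using lieb_sokal_leading_nonzero[of A B] AB False by blast
  have "0 \<le> Im (poly A t / poly B t)"
  proof (rule ccontr)
    assume "\<not> ?thesis"
    then have "0 < Im (- (poly A t / poly B t))"
      by simp
    from AB[OF t this] show False
      using nz[OF t] by simp
  qed
  moreover have "Im (poly (pderiv B) t / poly B t) \<le> 0"
    by (rule Im_logderiv_poly_nonpos[OF nz t])
  ultimately have "0 < Im (poly A t / poly B t - poly (pderiv B) t / poly B t + \<i> * of_real \<epsilon>)"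
    using \<open>0 < \<epsilon>\<close> by simp
  moreover have "poly A t - poly (pderiv B) t + \<i> * of_real \<epsilon> * poly B t
      = poly B t * (poly A t / poly B t - poly (pderiv B) t / poly B t + \<i> * of_real \<epsilon>)"
    using nz[OF t] by (simp add: field_simps)
  ultimately show ?thesis
    using nz[OF t] by (metis less_irrefl mult_eq_0_iff zero_complex.simps(2))
qed

section \<open>Evaluation and restriction to complex lines\<close>

lemma additive_peval: "Modules.additive (peval x)"
  unfolding peval_def[abs_def] by (rule additive_sum_keys) (simp add: Modules.additive_def distrib_right)

lemma peval_single:
  "peval x (Poly_Mapping.single m c) = c * (\<Prod>i\<in>Poly_Mapping.keys m. x i ^ Poly_Mapping.lookup m i)"
  by (simp add: peval_def)

lemma peval_pconst_mult: "peval x (pconst c * p) = c * peval x p"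
proof (rule additive_eqI[where f = "\<lambda>p. peval x (pconst c * p)" and g = "\<lambda>p. c * peval x p"])
  show "Modules.additive (\<lambda>p. peval x (pconst c * p))"
    using additive_peval[of x] by (simp add: Modules.additive_def distrib_left)
  show "Modules.additive (\<lambda>p. c * peval x p)"
    by (intro additive_mult_left additive_peval)
qed (simp add: pconst_mult_single peval_single mult_ac)

text \<open>The restriction of \<open>p\<close> to the line through \<open>a\<close> in direction
  \<open>d\<close>, as a univariate polynomial. A unit vector \<open>d\<close> isolates one
  variable; a general \<open>d\<close> joins two points in the stability proof.\<close>

definition line_poly :: "(nat \<Rightarrow> complex) \<Rightarrow> (nat \<Rightarrow> complex) \<Rightarrow> cpoly \<Rightarrow> complex poly" where
  "line_poly a d p = (\<Sum>m\<in>Poly_Mapping.keys p. smult (Poly_Mapping.lookup p m)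
      (\<Prod>i\<in>Poly_Mapping.keys m. [:a i, d i:] ^ Poly_Mapping.lookup m i))"

lemma poly_line_poly: "poly (line_poly a d p) s = peval (\<lambda>i. a i + s * d i) p"
  by (simp add: line_poly_def peval_def poly_sum poly_prod)

lemma additive_line_poly: "Modules.additive (line_poly a d)"
  unfolding line_poly_def[abs_def] by (rule additive_sum_keys) (simp add: Modules.additive_def smult_add_left)

lemma line_poly_single:
  assumes "finite A" "Poly_Mapping.keys m \<subseteq> A"
  shows "line_poly a d (Poly_Mapping.single m c)
    = smult c (\<Prod>i\<in>A. [:a i, d i:] ^ Poly_Mapping.lookup m i)"
proof -
  have "(\<Prod>i\<in>Poly_Mapping.keys m. [:a i, d i:] ^ Poly_Mapping.lookup m i)
      = (\<Prod>i\<in>A. [:a i, d i:] ^ Poly_Mapping.lookup m i)"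
    using assms by (intro prod.mono_neutral_left) (auto simp: in_keys_iff)
  then show ?thesis
    by (simp add: line_poly_def)
qed

lemma pderiv_line_poly:
  assumes d: "d = (\<lambda>j. if j = i then 1 else 0)"
  shows "pderiv (line_poly a d p) = line_poly a d (partial i p)"
proof (rule additive_eqI[where f = "\<lambda>p. pderiv (line_poly a d p)" and g = "\<lambda>p. line_poly a d (partial i p)"])
  show "Modules.additive (\<lambda>p. pderiv (line_poly a d p))"
    using additive_line_poly[of a d] by (simp add: Modules.additive_def pderiv_add)
  show "Modules.additive (\<lambda>p. line_poly a d (partial i p))"
    by (rule additive_comp[OF additive_line_poly additive_partial])
  fix m :: "nat \<Rightarrow>\<^sub>0 nat" and c
  define A where "A = Poly_Mapping.keys m"
  define k where "k = Poly_Mapping.lookup m i"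
  \<comment> \<open>The factors in the variables other than \<open>x_i\<close> are constant along
    the line, because \<open>d\<close> vanishes there.\<close>
  define R where "R = (\<Prod>j\<in>A - {i}. [:a j ^ Poly_Mapping.lookup m j:])"
  have "finite A"
    by (simp add: A_def)
  have line: "line_poly a d (Poly_Mapping.single m' c') = smult c' ([:a i, 1:] ^ Poly_Mapping.lookup m' i * R)"
    if other: "\<And>j. j \<noteq> i \<Longrightarrow> Poly_Mapping.lookup m' j = Poly_Mapping.lookup m j" for m' c'
  proof -
    have "j \<in> insert i A" if "j \<in> Poly_Mapping.keys m'" for j
      using that other[of j] by (cases "j = i") (simp_all add: in_keys_iff A_def)
    then have "Poly_Mapping.keys m' \<subseteq> insert i A"
      by blast
    then have "line_poly a d (Poly_Mapping.single m' c')
        = smult c' (\<Prod>j\<in>insert i (A - {i}). [:a j, d j:] ^ Poly_Mapping.lookup m' j)"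
      using \<open>finite A\<close> by (subst line_poly_single[of "insert i A"]) auto
    also have "(\<Prod>j\<in>A - {i}. [:a j, d j:] ^ Poly_Mapping.lookup m' j) = R"
      unfolding R_def by (intro prod.cong refl) (auto simp: d other simp flip: poly_const_pow)
    then have "(\<Prod>j\<in>insert i (A - {i}). [:a j, d j:] ^ Poly_Mapping.lookup m' j)
        = [:a i, 1:] ^ Poly_Mapping.lookup m' i * R"
      using \<open>finite A\<close> by (subst prod.insert) (auto simp: d)
    finally show ?thesis .
  qed
  have "pderiv (\<Prod>j\<in>F. [:c j:]) = 0" for F and c :: "nat \<Rightarrow> complex"
    by (induction F rule: infinite_finite_induct) (simp_all add: pderiv_smult)
  then have "pderiv R = 0"
    by (simp add: R_def)
  then have "pderiv (line_poly a d (Poly_Mapping.single m c))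
      = smult c (pderiv ([:a i, 1:] ^ k) * R)"
    by (subst line) (auto simp: pderiv_smult pderiv_mult k_def mult.commute)
  also have "pderiv ([:a i, 1:] ^ k) = smult (of_nat k) ([:a i, 1:] ^ (k - 1))"
    by (simp add: pderiv_power pderiv_pCons)
  finally show "pderiv (line_poly a d (Poly_Mapping.single m c))
      = line_poly a d (partial i (Poly_Mapping.single m c))"
    unfolding partial_single
    by (subst line) (auto simp: lookup_minus lookup_single k_def mult_ac)
qed

section \<open>Substituting shifted derivatives\<close>

lemma additive_pderiv: "Modules.additive (pderiv :: complex poly \<Rightarrow> complex poly)"
  by (simp add: Modules.additive_def pderiv_add)

lemma sum_Pow_insert:
  assumes "finite A" "a \<notin> A"
  shows "(\<Sum>S\<in>Pow (insert a A). F S) = (\<Sum>S\<in>Pow A. F S) + (\<Sum>S\<in>Pow A. F (insert a S))"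
proof -
  have "inj_on (insert a) (Pow A)"
    using assms(2) by (auto simp: inj_on_def)
  then have "sum F (insert a ` Pow A) = (\<Sum>S\<in>Pow A. F (insert a S))"
    by (simp add: sum.reindex)
  moreover have "sum F (Pow (insert a A)) = sum F (Pow A) + sum F (insert a ` Pow A)"
    unfolding Pow_insert using assms by (intro sum.union_disjoint) auto
  ultimately show ?thesis by simp
qed

definition shifted_Del :: "real \<Rightarrow> nat \<Rightarrow> diffop" where
  "shifted_Del \<epsilon> i = Del i - pconst (\<i> * of_real \<epsilon>)"

lemma peval_apply_shifted_Del:
  "peval x (apply_op (shifted_Del \<epsilon> i) p) = peval x (partial i p) - \<i> * of_real \<epsilon> * peval x p"
  by (simp add: shifted_Del_def apply_op_diff_left apply_op_Del apply_op_pconst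
      Modules.additive.diff[OF additive_peval] peval_pconst_mult)

text \<open>
  The induction treats the polynomial attached to \<open>S\<close> as arbitrary: substituting for \<open>w\<^sub>j\<close> merges the
  polynomials attached to \<open>S\<close> and \<open>S \<union> {j}\<close> and leaves a family indexed by the subsets of \<open>e - {j}\<close>.
\<close>

lemma substitute_shifted_derivatives_nonzero:
  assumes "finite e" "e \<subseteq> V" "0 < \<epsilon>"
    and "\<And>x (w :: nat \<Rightarrow> complex). (\<And>i. i \<in> V \<Longrightarrow> 0 < Im (x i)) \<Longrightarrow> (\<And>i. 0 < Im (w i)) \<Longrightarrow>
      (\<Sum>S\<in>Pow e. (\<Prod>i\<in>S. - w i) * peval x (g S)) \<noteq> 0"
    and x: "\<And>i. i \<in> V \<Longrightarrow> 0 < Im (x i)"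
  shows "peval x (\<Sum>S\<in>Pow e. apply_op (\<Prod>i\<in>S. shifted_Del \<epsilon> i) (g S)) \<noteq> 0"
  using assms(1,2,4)
proof (induction e arbitrary: g)
  case empty
  show ?case
    using empty.prems(2)[of x "\<lambda>_. \<i>"] x by simp
next
  case (insert j e)
  define g' where "g' S = g S + apply_op (shifted_Del \<epsilon> j) (g (insert j S))" for S
  have jS: "j \<notin> S" "finite S" if "S \<in> Pow e" for S
    using that insert.hyps finite_subset by auto
  have "peval x (\<Sum>S\<in>Pow e. apply_op (\<Prod>i\<in>S. shifted_Del \<epsilon> i) (g' S)) \<noteq> 0"
  proof (rule insert.IH)
    show "e \<subseteq> V"
      using insert.prems(1) by simp
    fix y w :: "nat \<Rightarrow> complex"
    assume y: "\<And>i. i \<in> V \<Longrightarrow> 0 < Im (y i)" and w: "\<And>i. 0 < Im (w i)"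
    define d :: "nat \<Rightarrow> complex" where "d = (\<lambda>i. if i = j then 1 else 0)"
    define L where "L = line_poly (y(j := 0)) d"
    define A where "A = (\<Sum>S\<in>Pow e. smult (\<Prod>i\<in>S. - w i) (L (g S)))"
    \<comment> \<open>The minus sign absorbs the one in \<open>- w j\<close>: in
      \<open>A + v * B\<close> the variable \<open>v\<close> plays the role of \<open>w j\<close>,
      and replacing \<open>v\<close> by \<open>-d/dt + \<i> * \<epsilon>\<close> turns
      \<open>- v\<close> into the shifted derivative.\<close>
    define B where "B = - (\<Sum>S\<in>Pow e. smult (\<Prod>i\<in>S. - w i) (L (g (insert j S))))"
    have "(\<lambda>i. (y(j := 0)) i + t * d i) = y(j := t)" for t
      by (auto simp: d_def)
    then have L: "poly (L p) t = peval (y(j := t)) p" for p t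
      by (simp add: L_def poly_line_poly)
    have "poly A (y j) - poly (pderiv B) (y j) + \<i> * of_real \<epsilon> * poly B (y j) \<noteq> 0"
    proof (rule lieb_sokal_strict)
      show "0 < Im (y j)"
        using y insert.prems(1) by simp
      fix t v :: complex
      assume t: "0 < Im t" and v: "0 < Im v"
      have "poly A t + v * poly B t
          = (\<Sum>S\<in>Pow e. (\<Prod>i\<in>S. - w i) * peval (y(j := t)) (g S))
            + (\<Sum>S\<in>Pow e. - v * ((\<Prod>i\<in>S. - w i) * peval (y(j := t)) (g (insert j S))))"
        by (simp add: A_def B_def poly_sum L sum_distrib_left sum_negf)
      also have "\<dots> = (\<Sum>S\<in>Pow (insert j e). (\<Prod>i\<in>S. - (w(j := v)) i) * peval (y(j := t)) (g S))"
      proof -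
        have "(\<Prod>i\<in>S. - (w(j := v)) i) = (\<Prod>i\<in>S. - w i)"
          "(\<Prod>i\<in>insert j S. - (w(j := v)) i) = - v * (\<Prod>i\<in>S. - w i)" if "S \<in> Pow e" for S
        proof -
          show *: "(\<Prod>i\<in>S. - (w(j := v)) i) = (\<Prod>i\<in>S. - w i)"
            using jS[OF that] by (intro prod.cong) auto
          show "(\<Prod>i\<in>insert j S. - (w(j := v)) i) = - v * (\<Prod>i\<in>S. - w i)"
            using jS[OF that] * by (subst prod.insert) auto
        qed
        then show ?thesis
          unfolding sum_Pow_insert[OF insert.hyps]
          by (intro arg_cong2[where f = "(+)"] sum.cong refl) (simp_all only: mult.assoc)
      qed
      also have "\<dots> \<noteq> 0"
        by (rule insert.prems(2)) (use y w t v in auto)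
      finally show "poly A t + v * poly B t \<noteq> 0" .
    qed (rule \<open>0 < \<epsilon>\<close>)
    moreover have "pderiv B = - (\<Sum>S\<in>Pow e. smult (\<Prod>i\<in>S. - w i) (L (partial j (g (insert j S)))))"
      by (simp add: B_def pderiv_minus Modules.additive.sum[OF additive_pderiv] pderiv_smult L_def pderiv_line_poly[OF d_def])
    ultimately show "(\<Sum>S\<in>Pow e. (\<Prod>i\<in>S. - w i) * peval y (g' S)) \<noteq> 0"
      by (simp add: A_def B_def poly_sum L g'_def Modules.additive.add[OF additive_peval]
          peval_apply_shifted_Del sum_distrib_left sum_subtractf sum.distrib algebra_simps)
  qed
  moreover have "(\<Sum>S\<in>Pow e. apply_op (\<Prod>i\<in>S. shifted_Del \<epsilon> i) (g' S))
      = (\<Sum>S\<in>Pow (insert j e). apply_op (\<Prod>i\<in>S. shifted_Del \<epsilon> i) (g S))"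
    unfolding sum_Pow_insert[OF insert.hyps] sum.distrib[symmetric]
  proof (intro sum.cong refl)
    fix S assume "S \<in> Pow e"
    from jS[OF this] have "(\<Prod>i\<in>insert j S. shifted_Del \<epsilon> i) = (\<Prod>i\<in>S. shifted_Del \<epsilon> i) * shifted_Del \<epsilon> j"
      by (simp add: mult.commute)
    then show "apply_op (\<Prod>i\<in>S. shifted_Del \<epsilon> i) (g' S)
        = apply_op (\<Prod>i\<in>S. shifted_Del \<epsilon> i) (g S) + apply_op (\<Prod>i\<in>insert j S. shifted_Del \<epsilon> i) (g (insert j S))"
      by (simp add: g'_def apply_op_add apply_op_mult)
  qed
  ultimately show ?case by simp
qed


section \<open>Stability\<close>

text \<open>Writing \<open>v / (1 + v) = 1 - 1 / (1 + v)\<close> shows that this quotient has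
  negative imaginary part. Hence one minus the sum of the quotients has positive imaginary part if
  \<open>e\<close> is nonempty, and equals 1 otherwise.\<close>

lemma relaxed_symbol_nonzero:
  fixes v :: "'a \<Rightarrow> complex"
  assumes e: "finite e" and v: "\<And>i. Im (v i) < 0"
  shows "(\<Sum>S\<in>Pow e. (1 - of_nat (card S)) * (\<Prod>i\<in>S. v i)) \<noteq> 0"
proof -
  have nz: "1 + v i \<noteq> 0" for i
    using v[of i] by (auto simp: complex_eq_iff)
  define P where "P = (\<Prod>i\<in>e. 1 + v i)"
  have "(\<Sum>S\<in>Pow e. of_nat (card S) * (\<Prod>i\<in>S. v i))
      = (\<Sum>i\<in>e. \<Sum>S\<in>Pow (e - {i}). \<Prod>j\<in>insert i S. v j)"
    by (rule sum_insert_Pow_eq_card[OF e, symmetric])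
  also have "\<dots> = (\<Sum>i\<in>e. v i * (\<Prod>j\<in>e - {i}. 1 + v j))"
  proof (rule sum.cong[OF refl])
    fix i assume "i \<in> e"
    have "(\<Prod>j\<in>insert i S. v j) = v i * (\<Prod>j\<in>S. v j)" if "S \<in> Pow (e - {i})" for S
      using that e finite_subset[of S e] by (subst prod.insert) auto
    then show "(\<Sum>S\<in>Pow (e - {i}). \<Prod>j\<in>insert i S. v j) = v i * (\<Prod>j\<in>e - {i}. 1 + v j)"
      using e by (simp add: prod_one_plus sum_distrib_left)
  qed
  also have "\<dots> = (\<Sum>i\<in>e. P * (v i / (1 + v i)))"
  proof (rule sum.cong[OF refl])
    fix i assume "i \<in> e"
    then have "P = (1 + v i) * (\<Prod>j\<in>e - {i}. 1 + v j)"
      unfolding P_def using e by (rule prod.remove[rotated])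
    then show "v i * (\<Prod>j\<in>e - {i}. 1 + v j) = P * (v i / (1 + v i))"
      using nz[of i] by (simp add: field_simps)
  qed
  finally have "(\<Sum>S\<in>Pow e. (1 - of_nat (card S)) * (\<Prod>i\<in>S. v i)) = P * (1 - (\<Sum>i\<in>e. v i / (1 + v i)))"
    by (simp add: left_diff_distrib sum_subtractf prod_one_plus[OF e] P_def right_diff_distrib sum_distrib_left)
  moreover have "P \<noteq> 0"
    using e nz by (simp add: P_def)
  moreover have "1 - (\<Sum>i\<in>e. v i / (1 + v i)) \<noteq> 0"
  proof (cases "e = {}")
    case False
    have "Im (v i / (1 + v i)) < 0" for i
    proof -
      have "v i / (1 + v i) = 1 - 1 / (1 + v i)"
        using nz[of i] by (simp add: field_simps)
      moreover have "0 < Im (1 / (1 + v i))"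
      proof -
        have "0 < (1 + Re (v i))\<^sup>2 + (Im (v i))\<^sup>2"
          using v[of i] by (intro add_nonneg_pos) auto
        then show ?thesis
          using v[of i] by (simp add: Im_divide divide_neg_pos)
      qed
      ultimately show ?thesis by simp
    qed
    then have "(\<Sum>i\<in>e. Im (v i / (1 + v i))) < 0"
      using e False sum_strict_mono[of e "\<lambda>i. Im (v i / (1 + v i))" "\<lambda>_. 0"] by simp
    then have "Im (1 - (\<Sum>i\<in>e. v i / (1 + v i))) \<noteq> 0"
      by simp
    then show ?thesis
      by (metis zero_complex.simps(2))
  qed simp
  ultimately show ?thesis by simp
qed

text \<open>The multiaffine symbol of \<open>e\<close> with every \<open>Del i\<close> replaced by
  \<open>Del i - c\<close>. The value \<open>c = 0\<close> gives back the symbol itself, and the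
  shift is a parameter so that it can tend to 0.\<close>

definition shifted_symbol :: "complex \<Rightarrow> nat set \<Rightarrow> diffop" where
  "shifted_symbol c e = (\<Sum>S\<in>Pow e. pconst (1 - of_nat (card S)) * (\<Prod>i\<in>S. Del i - pconst c))"

lemma apply_shifted_symbol_nonzero:
  assumes e: "finite e" "e \<subseteq> V" and "0 < \<epsilon>"
    and f: "\<And>x. (\<And>i. i \<in> V \<Longrightarrow> 0 < Im (x i)) \<Longrightarrow> peval x f \<noteq> 0"
    and x: "\<And>i. i \<in> V \<Longrightarrow> 0 < Im (x i)"
  shows "peval x (apply_op (shifted_symbol (\<i> * of_real \<epsilon>) e) f) \<noteq> 0"
proof -
  \<comment> \<open>Every member of the family is a constant multiple of \<open>f\<close>, so the
    required sum factors into the edge symbol at \<open>- w\<close> and the value of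
    \<open>f\<close>.\<close>
  define g where "g S = pconst (1 - of_nat (card S)) * f" for S :: "nat set"
  have "peval x (\<Sum>S\<in>Pow e. apply_op (\<Prod>i\<in>S. shifted_Del \<epsilon> i) (g S)) \<noteq> 0"
  proof (rule substitute_shifted_derivatives_nonzero[OF e \<open>0 < \<epsilon>\<close> _ x])
    fix y w :: "nat \<Rightarrow> complex"
    assume y: "\<And>i. i \<in> V \<Longrightarrow> 0 < Im (y i)" and w: "\<And>i. 0 < Im (w i)"
    have "(\<Sum>S\<in>Pow e. (\<Prod>i\<in>S. - w i) * peval y (g S))
        = (\<Sum>S\<in>Pow e. (1 - of_nat (card S)) * (\<Prod>i\<in>S. - w i)) * peval y f"
      unfolding g_def peval_pconst_mult sum_distrib_right by (simp add: mult_ac)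
    moreover have "(\<Sum>S\<in>Pow e. (1 - of_nat (card S)) * (\<Prod>i\<in>S. - w i)) \<noteq> 0"
      using w by (intro relaxed_symbol_nonzero e(1)) simp
    ultimately show "(\<Sum>S\<in>Pow e. (\<Prod>i\<in>S. - w i) * peval y (g S)) \<noteq> 0"
      using f[of y] y by simp
  qed
  moreover have "apply_op A (pconst c * f) = apply_op (pconst c * A) f" for A c
    by (metis apply_op_mult apply_op_pconst mult.commute)
  then have "(\<Sum>S\<in>Pow e. apply_op (\<Prod>i\<in>S. shifted_Del \<epsilon> i) (g S))
      = apply_op (shifted_symbol (\<i> * of_real \<epsilon>) e) f"
    by (simp add: g_def shifted_symbol_def shifted_Del_def apply_op_sum_left)
  ultimately show ?thesis by simp
qed

text \<open>Each edge operator returns a polynomial satisfying the same nonvanishing condition that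
  it requires of its argument, so the edges can be applied one after another.\<close>

lemma apply_prod_shifted_symbol_nonzero:
  assumes "finite I" "\<And>e. e \<in> I \<Longrightarrow> finite (h e) \<and> h e \<subseteq> V" "0 < \<epsilon>"
    and f: "\<And>x. (\<And>i. i \<in> V \<Longrightarrow> 0 < Im (x i)) \<Longrightarrow> peval x f \<noteq> 0"
    and x: "\<And>i. i \<in> V \<Longrightarrow> 0 < Im (x i)"
  shows "peval x (apply_op (\<Prod>e\<in>I. shifted_symbol (\<i> * of_real \<epsilon>) (h e)) f) \<noteq> 0"
  using assms(1,2) x
proof (induction I arbitrary: x)
  case empty
  then show ?case using f[of x] by simp
next
  case (insert e I)
  have "peval x (apply_op (shifted_symbol (\<i> * of_real \<epsilon>) (h e))
      (apply_op (\<Prod>e\<in>I. shifted_symbol (\<i> * of_real \<epsilon>) (h e)) f)) \<noteq> 0"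
    by (rule apply_shifted_symbol_nonzero[where V = V]) (use insert \<open>0 < \<epsilon>\<close> in auto)
  then show ?case
    using insert.hyps by (simp add: apply_op_mult)
qed

section \<open>Letting the shift tend to zero\<close>

lemma prod_shifted_symbol_expansion:
  obtains N A where "\<And>c. (\<Prod>e\<in>I. shifted_symbol c (h e)) = (\<Sum>k\<le>N. pconst (c ^ k) * A k)"
proof -
  \<comment> \<open>The shift becomes the indeterminate of a polynomial over the ring of symbols;
    \<open>[:Del i, - 1:]\<close> stands for \<open>Del i - c\<close>.\<close>
  define Q :: "cpoly poly" where
    "Q = (\<Prod>e\<in>I. \<Sum>S\<in>Pow (h e). [:pconst (1 - of_nat (card S)):] * (\<Prod>i\<in>S. [:Del i, - 1:]))"
  have "(\<Prod>e\<in>I. shifted_symbol c (h e)) = poly Q (pconst c)" for c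
    by (simp add: Q_def shifted_symbol_def poly_prod poly_sum)
  then have "(\<Prod>e\<in>I. shifted_symbol c (h e)) = (\<Sum>k\<le>degree Q. pconst (c ^ k) * coeff Q k)" for c
    by (simp add: poly_altdef pconst_power mult.commute)
  then show thesis
    by (rule that)
qed

text \<open>Each summand is a convergent scalar times a polynomial in \<open>s\<close> that is
  bounded on the compact set. For \<open>k = 0\<close> both scalar powers are 1.\<close>

lemma uniform_limit_power_sum:
  fixes q :: "nat \<Rightarrow> complex poly"
  assumes "compact K" "c \<longlonglongrightarrow> 0"
  shows "uniform_limit K (\<lambda>n s. \<Sum>k\<le>N. c n ^ k * poly (q k) s) (\<lambda>s. \<Sum>k\<le>N. 0 ^ k * poly (q k) s) sequentially"
proof -
  have "uniform_limit K (\<lambda>n s. c n ^ k * poly (q k) s) (\<lambda>s. 0 ^ k * poly (q k) s) sequentially" for k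
  proof (rule uniform_lim_mult)
    have "(\<lambda>n. c n ^ k) \<longlonglongrightarrow> 0 ^ k"
      by (intro tendsto_intros assms)
    then show "uniform_limit K (\<lambda>n s. c n ^ k) (\<lambda>s. 0 ^ k) sequentially"
      by (auto simp: uniform_limit_iff tendsto_iff elim!: eventually_mono)
    show "bounded ((\<lambda>s. poly (q k) s) ` K)"
      by (intro compact_imp_bounded compact_continuous_image continuous_intros assms)
    show "bounded ((\<lambda>s. 0 ^ k) ` K)"
      by (rule bounded_subset[of "{0 ^ k}"]) auto
  qed (auto intro: uniform_limit_const)
  note term_limit = this
  show ?thesis
  proof (induction N)
    case 0
    show ?case using term_limit[of 0] by simp
  next
    case (Suc N)
    show ?case
      unfolding sum.atMost_Suc by (rule uniform_limit_add[OF Suc term_limit])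
  qed
qed

lemma peval_pvar_prod: "finite A \<Longrightarrow> peval x (\<Prod>i\<in>A. pvar i ^ k i) = (\<Prod>i\<in>A. x i ^ k i)"
proof -
  assume A: "finite A"
  let ?m = "\<Sum>i\<in>A. Poly_Mapping.single i (k i)"
  have "(\<Prod>i\<in>Poly_Mapping.keys ?m. x i ^ Poly_Mapping.lookup ?m i) = (\<Prod>i\<in>A. x i ^ k i)"
    using A by (intro prod.mono_neutral_cong_left) (auto simp: in_keys_iff lookup_sum_single split: if_splits)
  then show ?thesis
    using A by (simp add: prod_pvar_power peval_single)
qed

section \<open>A point where the polynomial does not vanish\<close>

lemma rel_deg_pos:
  assumes H: "hypergraph n I h" "K \<in> relaxed_subgraphs I h" and "fst K \<noteq> {}"
  obtains i where "i \<in> {1..n}" "0 < rel_deg K i"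
proof -
  note K = relaxed_subgraphD[OF H]
  obtain e where e: "e \<in> fst K"
    using \<open>fst K \<noteq> {}\<close> by blast
  with K(5) have "snd K e \<noteq> {}"
    by fastforce
  then obtain i where i: "i \<in> snd K e"
    by blast
  have "0 < rel_deg K i"
    unfolding rel_deg_def using K(1) e i by (subst card_gt_0_iff) auto
  with K(3)[OF e] i show thesis
    by (intro that) auto
qed

text \<open>On the diagonal \<open>eta\<close> becomes a univariate polynomial. Only the empty
  relaxed subgraph attains the top degree, the sum of all \<open>\<kappa> i\<close>, since any
  chosen set lowers the exponent at one of its vertices. Its coefficient is 1, so the polynomial has
  finitely many roots.\<close>

lemma eta_nonzero_in_half_plane:
  assumes H: "hypergraph n I h"
  obtains y where "0 < Im y" "peval (\<lambda>_. y) (eta n I h \<kappa>) \<noteq> 0"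
proof -
  let ?R = "relaxed_kappa_subgraphs n I h \<kappa>"
  define c where "c K = (of_int ((- 1) ^ card (fst K) * weight \<kappa> K) :: complex)" for K :: "'a relaxed"
  define D where "D K = (\<Sum>i\<in>{1..n}. \<kappa> i - rel_deg K i)" for K :: "'a relaxed"
  define U where "U = (\<Sum>K\<in>?R. monom (c K) (D K))"
  have U: "peval (\<lambda>_. y) (eta n I h \<kappa>) = poly U y" for y
  proof -
    have "(- 1) ^ card (fst K) * of_int (weight \<kappa> K) = pconst (c K)" for K :: "'a relaxed"
      unfolding c_def pconst_of_int by simp
    then have "eta n I h \<kappa> = (\<Sum>K\<in>?R. pconst (c K) * (\<Prod>i\<in>{1..n}. pvar i ^ (\<kappa> i - rel_deg K i)))"
      unfolding eta_def by simp
    then show ?thesis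
      by (simp add: U_def D_def Modules.additive.sum[OF additive_peval] peval_pconst_mult peval_pvar_prod
          poly_sum poly_monom power_sum)
  qed
  \<comment> \<open>The empty relaxed subgraph; extensionality forces its choice function to be
    \<open>undefined\<close> everywhere.\<close>
  define K0 :: "'a relaxed" where "K0 = ({}, \<lambda>_. undefined)"
  have "D K = D K0 \<longleftrightarrow> K = K0" if K: "K \<in> ?R" for K
  proof
    assume "D K = D K0"
    have K': "K \<in> relaxed_subgraphs I h" "\<And>i. i \<in> {1..n} \<Longrightarrow> rel_deg K i \<le> \<kappa> i"
      using K by (auto simp: relaxed_kappa_subgraphs_def)
    have "fst K = {}"
    proof (rule ccontr)
      assume "fst K \<noteq> {}"
      with rel_deg_pos[OF H K'(1)] obtain i where i: "i \<in> {1..n}" "0 < rel_deg K i"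
        by blast
      have "D K < (\<Sum>i\<in>{1..n}. \<kappa> i)"
        unfolding D_def using i K'(2)[OF i(1)] by (intro sum_strict_mono_ex1) (auto intro!: bexI[of _ i])
      also have "\<dots> = D K0"
        by (simp add: D_def K0_def rel_deg_def)
      finally show False
        using \<open>D K = D K0\<close> by simp
    qed
    then show "K = K0"
      using K'(1) by (auto simp: relaxed_subgraphs_def K0_def PiE_empty_domain)
  qed simp
  moreover have "K0 \<in> ?R"
    by (auto simp: relaxed_kappa_subgraphs_def relaxed_subgraphs_def K0_def rel_deg_def)
  ultimately have "coeff U (D K0) = c K0"
    using finite_relaxed_kappa_subgraphs[OF H, of \<kappa>]
    by (simp add: U_def coeff_sum cong: sum.cong)
  also have "c K0 = 1"
    by (simp add: c_def K0_def weight_def rel_verts_def)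
  finally have "U \<noteq> 0"
    by auto
  then have "finite {y. poly U y = 0}"
    by (rule poly_roots_finite)
  moreover have "infinite (range (\<lambda>k::nat. \<i> * of_nat (Suc k)))"
    by (intro range_inj_infinite) (auto simp: inj_on_def)
  ultimately have "\<not> range (\<lambda>k::nat. \<i> * of_nat (Suc k)) \<subseteq> {y. poly U y = 0}"
    using finite_subset by blast
  then obtain k where "poly U (\<i> * of_nat (Suc k)) \<noteq> 0"
    by blast
  then show thesis
    by (intro that[of "\<i> * of_nat (Suc k)"]) (simp_all add: U)
qed

section \<open>Hurwitz' theorem on a line\<close>

lemma eta_stable:
  assumes H: "hypergraph n I h"
  shows "stable_poly {1..n} (eta n I h \<kappa>)"
  unfolding stable_poly_def
proof (intro disjI2 allI impI)
  fix x :: "nat \<Rightarrow> complex"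
  assume x: "\<forall>i\<in>{1..n}. 0 < Im (x i)"
  obtain y where y: "0 < Im y" "peval (\<lambda>_. y) (eta n I h \<kappa>) \<noteq> 0"
    using eta_nonzero_in_half_plane[OF H] .
  obtain N A where A: "\<And>c. (\<Prod>e\<in>I. shifted_symbol c (h e)) = (\<Sum>k\<le>N. pconst (c ^ k) * A k)"
    using prod_shifted_symbol_expansion[where I = I and h = h] by blast
  define f where "f = (\<Prod>i\<in>{1..n}. pvar i ^ \<kappa> i)"
  \<comment> \<open>The line runs from the given point \<open>x\<close> at \<open>s = 0\<close> to
    the constant vector with entries \<open>y\<close> at \<open>s = 1\<close>, where
    \<open>eta\<close> is known to be nonzero.\<close>
  define q where "q k = line_poly x (\<lambda>i. y - x i) (apply_op (A k) f)" for k
  define F where "F c s = (\<Sum>k\<le>N. c ^ k * poly (q k) s)" for c s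
  \<comment> \<open>The parameters whose point on the line still has all its coordinates of index
    \<open>1..n\<close> in the upper half-plane; both 0 and 1 belong to it.\<close>
  define U where "U = {s. \<forall>i\<in>{1..n}. 0 < Im (x i + s * (y - x i))}"
  have F: "F c s = peval (\<lambda>i. x i + s * (y - x i)) (apply_op (\<Prod>e\<in>I. shifted_symbol c (h e)) f)" for c s
    unfolding A by (simp add: F_def q_def poly_line_poly apply_op_sum_left apply_op_pconst_mult
        Modules.additive.sum[OF additive_peval] peval_pconst_mult)
  have edges: "finite I" "\<And>e. e \<in> I \<Longrightarrow> finite (h e) \<and> h e \<subseteq> {1..n}"
    using H hypergraph_finite_edge[OF H] by (auto simp: hypergraph_def)
  have "(\<Prod>e\<in>I. shifted_symbol 0 (h e)) = (\<Prod>e\<in>I. MAP ((1 - Del_sum (h e)) * (\<Prod>i\<in>h e. 1 + Del i)))"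
    using edges(2) by (intro prod.cong refl) (simp add: MAP_relaxed_symbol shifted_symbol_def)
  then have F0: "F 0 s = peval (\<lambda>i. x i + s * (y - x i)) (eta n I h \<kappa>)" for s
    by (simp only: F eta_eq_apply_op[OF H] f_def)
  have "peval z f \<noteq> 0" if "\<And>i. i \<in> {1..n} \<Longrightarrow> 0 < Im (z i)" for z
    unfolding f_def using that by (fastforce simp: peval_pvar_prod)
  then have nz: "F (\<i> * of_real \<epsilon>) s \<noteq> 0" if "0 < \<epsilon>" "s \<in> U" for \<epsilon> s
    unfolding F using that edges
    by (intro apply_prod_shifted_symbol_nonzero[where V = "{1..n}"]) (auto simp: U_def)
  have "F 0 0 \<noteq> 0"
  \<comment> \<open>Hurwitz' theorem is applied to a nonconstant limit; a constant limit takes at 0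
    the value it has at 1.\<close>
  proof (cases "F 0 constant_on U")
    case True
    have "0 \<in> U" "1 \<in> U"
      using x y(1) by (auto simp: U_def)
    with True have "F 0 0 = F 0 1"
      by (metis constant_on_def)
    also have "\<dots> \<noteq> 0"
      using y(2) by (simp add: F0)
    finally show ?thesis .
  next
    case False
    show ?thesis
    proof (rule Hurwitz_no_zeros[of U "\<lambda>m. F (\<i> * of_real (inverse (of_nat (Suc m))))" "F 0"])
      have U: "U = (\<Inter>i\<in>{1..n}. {s. 0 < Im (x i + s * (y - x i))})"
        by (auto simp: U_def)
      show "open U"
        unfolding U by (intro open_INT finite_atLeastAtMost ballI open_Collect_less continuous_intros)
      \<comment> \<open>The imaginary part of a point on the line is a real-affine function of
        \<open>s\<close>, which makes \<open>U\<close> convex and therefore connected.\<close>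
      have "convex {s. 0 < Im (x i + s * (y - x i))}" for i
      proof -
        have "Im (x i + ((1 - u) *\<^sub>R s + u *\<^sub>R t) * (y - x i))
            = (1 - u) * Im (x i + s * (y - x i)) + u * Im (x i + t * (y - x i))" for s t u
          by (simp add: algebra_simps)
        moreover have "0 < (1 - u) * a + u * b" if "0 < a" "0 < b" "0 \<le> u" "u \<le> 1" for u a b :: real
          using that by (cases "u = 0") (auto intro: add_nonneg_pos)
        ultimately show ?thesis
          unfolding convex_alt by simp
      qed
      then show "connected U"
        unfolding U by (intro convex_connected convex_INT)
      show "F (\<i> * of_real (inverse (of_nat (Suc m)))) holomorphic_on U" for m
        unfolding F_def[abs_def] by (intro holomorphic_intros)
      show "F 0 holomorphic_on U"
        unfolding F_def[abs_def] by (intro holomorphic_intros)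
      show "uniform_limit K (\<lambda>m. F (\<i> * of_real (inverse (of_nat (Suc m))))) (F 0) sequentially"
        if "compact K" for K
      proof -
        have "(\<lambda>m. \<i> * complex_of_real (inverse (of_nat (Suc m)))) \<longlonglongrightarrow> \<i> * of_real 0"
          by (intro tendsto_intros LIMSEQ_inverse_real_of_nat)
        then show ?thesis
          unfolding F_def[abs_def] by (intro uniform_limit_power_sum that) simp
      qed
      show "F (\<i> * of_real (inverse (of_nat (Suc m)))) s \<noteq> 0" if "s \<in> U" for m s
        using that by (intro nz) auto
      show "0 \<in> U"
        using x by (simp add: U_def)
    qed (rule False)
  qed
  then show "peval x (eta n I h \<kappa>) \<noteq> 0"
    by (simp add: F0)
qed

theorem theorem5p6:
  fixes n :: nat and I :: "'e set" and h :: "'e \<Rightarrow> nat set" and \<kappa> :: "nat \<Rightarrow> nat"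
  assumes "hypergraph n I h"
  shows "stable_poly {1..n} (eta n I h \<kappa>) \<and>
    eta n I h \<kappa> =
      apply_op (\<Prod>e\<in>I. MAP ((1 - Del_sum (h e)) * (\<Prod>i\<in>h e. 1 + Del i)))
        (\<Prod>i\<in>{1..n}. pvar i ^ \<kappa> i)"
  using eta_stable[OF assms] eta_eq_apply_op[OF assms] by blast

end
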